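(* Let $\Sigma_0$ be a finite alphabet and let $L \subseteq \Sigma_0^*$ be any regular language. Then there is a decoder-only projected pre-norm transformer with strict causal saturated attention (with or without positional encodings) that, on input $\$x$ with $x \in \Sigma_0^*$, checks whether $x \in L$ with $|x|+1$ decoding steps; that is, after running $|x|+1$ decoding steps on input $\$x$, the last generated token is the accept symbol $1$ if and only if $x \in L$.
   Context: **Decoding.** The transformer works over a finite token vocabulary $\Sigma$ that contains the input alphabet $\Sigma_0$, a beginning-of-sequence symbol $\$$, a special accept symbol $1$, and possibly finitely many further symbols. It computes a next-token function $f:\Sigma^*\to\Sigma$. Put $f^0(x)=x$ and $f^{k+1}(x)=f^k(x)\cdot f(f^k(x))$ (concatenation). Running $k$ decoding steps on $x$ means computing $f^k(x)$. **Arithmetic.** $\mathbb D_p$ is the set of $p$-bit floating-point numbers; additions, (iterated) sums, products, divisions and the other scalar operations below return the exact result truncated to $p$ bits. Transformers are log-precision: there is a constant $c$ such that, when the input has length $n$ and $t(n)$ decoding steps are run, $p \le c\log(n+t(n))$. All other hyperparameters and weights are fixed, independent of $n$. **Transformer.** Fix a number of heads $h$, layers $d$, model dimension $m$ (divisible by $h$), feedforward width $w$. On a token sequence $x_1\cdots x_N$ the next token is computed as follows. 1. Embedding: $\mathbf h^0_i = \mathbf v_{x_i} + g(i)$, where $\mathbf v_\sigma\in\mathbb D_p^m$ is a learned vector for each $\sigma \in \Sigma$ and $g:\mathbb N\to\mathbb D_p^m$ is a positional encoding computable in time $O(\log N)$. "Without positional encodings" means $g\equiv 0$. 2. Projected pre-norm: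 $\mathsf{layer\_norm}(\mathbf x)=\mathbf x'/\|\mathbf x'\|$, where $\mathbf x'=\mathbf x-\bar x$ and $\bar x$ is the mean of the coordinates of $\mathbf x$ (the value is $\mathbf 0$ if $\mathbf x'=\mathbf 0$). Each sublayer (attention or feedforward) has its own parameter matrix $\mathbf M\in \mathbb R^{m\times m}$ and reads its input $\mathbf v$ only through $\mathsf{layer\_norm}(\mathbf M\mathbf v)$. 3. Attention in layer $\ell$: let $\bar{\mathbf h}_i$ be the projected pre-norm of $\mathbf h_i^{\ell-1}$. Head $k$ uses affine maps to form queries $\mathbf q_i$, keys $\mathbf k_i$, values $\mathbf u_i\in\mathbb D_p^{m/h}$ from $\bar{\mathbf h}_i$. With strict causal saturated attention, the head output $\mathbf a_{i,k}$ at position $i$ is the uniform average of $\mathbf u_j$ over all $j\in\{1,\dots,i-1\}$ maximizing $\mathbf q_i^\top\mathbf k_j$ (and $\mathbf 0$ if $i$ is the first position). 4. Activation block: $\mathbf o_i=\mathbf W_o\mathbf a_i+\mathbf b_o+\mathbf h_i^{\ell-1}$, where $\mathbf a_i$ concatenates the head outputs; then, with $\bar{\mathbf o}_i$ the projected pre-norm of $\mathbf o_i$, $\mathbf h^\ell_i=\mathbf W_2\,\mathrm{ReLU}(\mathbf W_1\bar{\mathbf o}_i+\mathbf b_1)+\mathbf b_2+\mathbf o_i$, with inner dimension $w$. 5. Output: the next token is $\gamma(\mathbf h^d_N)$, where $\gamma$ is a linear map to $\mathbb D_p^{|\Sigma|}$ followed by taking the symbol with the largest score. *)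

theory Defs
  imports Complex_Main "HOL-Library.Landau_Symbols"
begin

section \<open>Regular languages\<close>

text \<open>Acceptance by a complete deterministic finite automaton with state set \<open>Q\<close>.\<close>

definition regular_language :: "'a set \<Rightarrow> 'a list set \<Rightarrow> bool" where
  "regular_language A L \<longleftrightarrow>
     (\<exists>(Q :: nat set) \<delta> q0 F.
        finite Q \<and> q0 \<in> Q \<and> F \<subseteq> Q \<and> (\<forall>q\<in>Q. \<forall>a\<in>A. \<delta> q a \<in> Q) \<and>
        L = {w \<in> lists A. foldl \<delta> q0 w \<in> F})"


section \<open>Floating-point arithmetic with p bits\<close>

text \<open>
  A float is a pair of signed integers \<open>(m, e)\<close>, denoting \<open>m * 2 powi e\<close>, that takes at most
  \<open>p\<close> bits in total: \<open>a\<close> bits for the absolute value of \<open>m\<close>, \<open>b\<close> bits for that of \<open>e\<close>, and two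
  sign bits. Both mantissa and exponent are bounded, so \<open>floats p\<close> is a finite set.
\<close>

definition floats :: "nat \<Rightarrow> real set" where
  "floats p = {of_int m * 2 powi e | (m :: int) (e :: int) (a :: nat) (b :: nat).
                 a + b + 2 \<le> p \<and> \<bar>m\<bar> < 2 ^ a \<and> \<bar>e\<bar> < 2 ^ b}"

text \<open>
  Truncation rounds towards zero within \<open>floats p\<close>. It saturates at the largest float and flushes values that are
  too small to zero. The set below is nonempty as soon as \<open>p \<ge> 2\<close>.
\<close>

definition trunc :: "nat \<Rightarrow> real \<Rightarrow> real" where
  "trunc p x = sgn x * Max {y \<in> floats p. 0 \<le> y \<and> y \<le> \<bar>x\<bar>}"

text \<open>
  Vectors and matrices have explicit dimensions and are indexed from 0; entries outside the
  dimensions are irrelevant. Every scalar operation and every iterated sum is truncated.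
\<close>

type_synonym rvec = "nat \<Rightarrow> real"
type_synonym rmat = "nat \<Rightarrow> nat \<Rightarrow> real"

definition vec_in :: "nat \<Rightarrow> nat \<Rightarrow> rvec \<Rightarrow> bool" where
  "vec_in p n v \<longleftrightarrow> (\<forall>i<n. v i \<in> floats p)"

definition mat_in :: "nat \<Rightarrow> nat \<Rightarrow> nat \<Rightarrow> rmat \<Rightarrow> bool" where
  "mat_in p r c W \<longleftrightarrow> (\<forall>i<r. vec_in p c (W i))"

definition dot :: "nat \<Rightarrow> nat \<Rightarrow> rvec \<Rightarrow> rvec \<Rightarrow> real" where
  "dot p n x y = trunc p (\<Sum>i<n. trunc p (x i * y i))"

definition matvec :: "nat \<Rightarrow> nat \<Rightarrow> rmat \<Rightarrow> rvec \<Rightarrow> rvec" where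
  "matvec p n W x = (\<lambda>i. dot p n (W i) x)"

definition vadd :: "nat \<Rightarrow> rvec \<Rightarrow> rvec \<Rightarrow> rvec" where
  "vadd p x y = (\<lambda>i. trunc p (x i + y i))"

definition affine :: "nat \<Rightarrow> nat \<Rightarrow> rmat \<Rightarrow> rvec \<Rightarrow> rvec \<Rightarrow> rvec" where
  "affine p n W b x = vadd p (matvec p n W x) b"

definition centered :: "nat \<Rightarrow> nat \<Rightarrow> rvec \<Rightarrow> rvec" where
  "centered p m x =
     (let mean = trunc p (trunc p (\<Sum>i<m. x i) / real m) in (\<lambda>i. trunc p (x i - mean)))"

definition layer_norm :: "nat \<Rightarrow> nat \<Rightarrow> rvec \<Rightarrow> rvec" where
  "layer_norm p m x =
     (let x' = centered p m x; nrm = trunc p (sqrt (dot p m x' x'))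
      in if \<forall>i<m. x' i = 0 then (\<lambda>i. 0) else (\<lambda>i. trunc p (x' i / nrm)))"

definition proj_norm :: "nat \<Rightarrow> nat \<Rightarrow> rmat \<Rightarrow> rvec \<Rightarrow> rvec" where
  "proj_norm p m M v = layer_norm p m (matvec p m M v)"


section \<open>Functions computable in logarithmic time\<close>

text \<open>
  Deterministic multi-tape Turing machines with states \<open>{..<tm_states M}\<close>, tape symbols
  \<open>{..<tm_symbols M}\<close> and tapes \<open>{..<tm_tapes M}\<close>, each infinite to the right. State 0 is the
  initial state. Symbol 0 is the blank, 1 and 2 are the binary digits, and 3 is the minus sign.
\<close>

datatype move = Move_Left | Move_Stay | Move_Right

record turing_machine =
  tm_states :: nat
  tm_symbols :: nat
  tm_tapes :: nat
  tm_halt :: nat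
  tm_delta :: "nat \<Rightarrow> (nat \<Rightarrow> nat) \<Rightarrow> nat \<times> (nat \<Rightarrow> nat) \<times> (nat \<Rightarrow> move)"

definition tm_wf :: "turing_machine \<Rightarrow> bool" where
  "tm_wf M \<longleftrightarrow>
     0 < tm_states M \<and> tm_halt M < tm_states M \<and> 4 \<le> tm_symbols M \<and>
     (\<forall>q < tm_states M. \<forall>r. (\<forall>j. r j < tm_symbols M) \<longrightarrow>
        (case tm_delta M q r of (q', w, mv) \<Rightarrow>
           q' < tm_states M \<and> (\<forall>j < tm_tapes M. w j < tm_symbols M)))"

text \<open>A configuration consists of the state, the head positions and the tape contents.\<close>

type_synonym tm_config = "nat \<times> (nat \<Rightarrow> nat) \<times> (nat \<Rightarrow> nat \<Rightarrow> nat)"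

fun move_head :: "move \<Rightarrow> nat \<Rightarrow> nat" where
  "move_head Move_Left i = i - 1"
| "move_head Move_Stay i = i"
| "move_head Move_Right i = i + 1"

fun tm_step :: "turing_machine \<Rightarrow> tm_config \<Rightarrow> tm_config" where
  "tm_step M (q, pos, tp) =
     (if q = tm_halt M then (q, pos, tp)
      else (case tm_delta M q (\<lambda>j. if j < tm_tapes M then tp j (pos j) else 0) of (q', w, mv) \<Rightarrow>
              (q', \<lambda>j. move_head (mv j) (pos j), \<lambda>j. (tp j)(pos j := w j))))"

text \<open>Binary encodings, least significant digit first.\<close>

fun nat_code :: "nat \<Rightarrow> nat list" where
  "nat_code n = (if n = 0 then [] else (1 + n mod 2) # nat_code (n div 2))"

declare nat_code.simps [simp del]

definition int_code :: "int \<Rightarrow> nat list" where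
  "int_code z = (if z < 0 then [3] else []) @ nat_code (nat \<bar>z\<bar>)"

definition tape_of :: "nat list \<Rightarrow> nat \<Rightarrow> nat" where
  "tape_of s = (\<lambda>i. if i < length s then s ! i else 0)"

definition tm_init :: "nat \<Rightarrow> tm_config" where
  "tm_init N = (0, \<lambda>_. 0, \<lambda>j. if j = 0 then tape_of (nat_code N) else tape_of [])"

text \<open>
  \<open>g\<close> maps a position, given in binary on tape 0, to an \<open>m\<close>-dimensional vector of floats:
  on halting, mantissa and exponent of coordinate \<open>c\<close> are on tapes \<open>2 * c + 1\<close> and \<open>2 * c + 2\<close>.
\<close>

definition log_time_computable :: "nat \<Rightarrow> (nat \<Rightarrow> rvec) \<Rightarrow> bool" where
  "log_time_computable m g \<longleftrightarrow>
     (\<exists>M (time :: nat \<Rightarrow> nat).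
        tm_wf M \<and> 2 * m + 1 \<le> tm_tapes M \<and>
        (\<lambda>N. real (time N)) \<in> O(\<lambda>N. log 2 (real N)) \<and>
        (\<forall>N. \<exists>pos tp. (tm_step M ^^ time N) (tm_init N) = (tm_halt M, pos, tp) \<and>
           (\<forall>c<m. \<exists>a e :: int. g N c = of_int a * 2 powi e \<and>
              tp (2 * c + 1) = tape_of (int_code a) \<and>
              tp (2 * c + 2) = tape_of (int_code e))))"


section \<open>Transformers\<close>

text \<open>
  The vocabulary contains the input alphabet, the beginning-of-sequence symbol \<open>Bos\<close> (written
  \<open>$\<close>), the accept symbol \<open>Accept\<close> (written \<open>1\<close>), and \<open>r\<close> further symbols.
\<close>

datatype 'a token = Input 'a | Bos | Accept | Extra nat

definition vocab :: "'a set \<Rightarrow> nat \<Rightarrow> 'a token set" where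
  "vocab A r = Input ` A \<union> {Bos, Accept} \<union> Extra ` {..<r}"

record head_params =
  wq :: rmat  bq :: rvec
  wk :: rmat  bk :: rvec
  wu :: rmat  bu :: rvec

record layer_params =
  att_proj :: rmat
  att_heads :: "nat \<Rightarrow> head_params"
  wo :: rmat  bo :: rvec
  ff_proj :: rmat
  w1 :: rmat  b1 :: rvec
  w2 :: rmat  b2 :: rvec

record 'a transformer =
  n_heads :: nat
  n_layers :: nat
  dim :: nat
  ff_width :: nat
  n_extra :: nat
  emb :: "'a token \<Rightarrow> rvec"
  pos_enc :: "nat \<Rightarrow> rvec"
  layers :: "nat \<Rightarrow> layer_params"
  out_map :: "'a token \<Rightarrow> rvec"

definition head_dim :: "'a transformer \<Rightarrow> nat" where
  "head_dim T = dim T div n_heads T"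

text \<open>
  Positions are counted from 1. \<open>X j\<close> is the normalized input of the attention sublayer at
  position \<open>j\<close>, and position \<open>i\<close> attends to those among the positions \<open>1, ..., i - 1\<close> whose
  score is maximal.
\<close>

definition attn_head ::
  "nat \<Rightarrow> nat \<Rightarrow> nat \<Rightarrow> head_params \<Rightarrow> (nat \<Rightarrow> rvec) \<Rightarrow> nat \<Rightarrow> rvec" where
  "attn_head p m dh P X i =
     (let q = affine p m (wq P) (bq P) (X i);
          score = (\<lambda>j. dot p dh q (affine p m (wk P) (bk P) (X j)));
          S = {j. is_arg_max score (\<lambda>j. j \<in> {1..<i}) j}
      in if i \<le> 1 then (\<lambda>c. 0)
         else (\<lambda>c. trunc p (trunc p (\<Sum>j\<in>S. affine p m (wu P) (bu P) (X j) c) / real (card S))))"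

definition attn_sublayer ::
  "nat \<Rightarrow> 'a transformer \<Rightarrow> layer_params \<Rightarrow> (nat \<Rightarrow> rvec) \<Rightarrow> nat \<Rightarrow> rvec" where
  "attn_sublayer p T P H i =
     (let m = dim T; dh = head_dim T;
          X = (\<lambda>j. proj_norm p m (att_proj P) (H j));
          a = (\<lambda>c. attn_head p m dh (att_heads P (c div dh)) X i (c mod dh))
      in vadd p (affine p m (wo P) (bo P) a) (H i))"

definition ff_sublayer :: "nat \<Rightarrow> 'a transformer \<Rightarrow> layer_params \<Rightarrow> rvec \<Rightarrow> rvec" where
  "ff_sublayer p T P o' =
     (let m = dim T;
          z = affine p m (w1 P) (b1 P) (proj_norm p m (ff_proj P) o')
      in vadd p (affine p (ff_width T) (w2 P) (b2 P) (\<lambda>c. max 0 (z c))) o')"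

text \<open>\<open>hidden p T xs l i\<close> is the residual stream after \<open>l\<close> layers at position \<open>i\<close>.\<close>

primrec hidden :: "nat \<Rightarrow> 'a transformer \<Rightarrow> 'a token list \<Rightarrow> nat \<Rightarrow> nat \<Rightarrow> rvec" where
  "hidden p T xs 0 = (\<lambda>i. vadd p (emb T (xs ! (i - 1))) (pos_enc T i))"
| "hidden p T xs (Suc l) =
     (\<lambda>i. ff_sublayer p T (layers T l) (attn_sublayer p T (layers T l) (hidden p T xs l) i))"

definition next_token :: "'a set \<Rightarrow> nat \<Rightarrow> 'a transformer \<Rightarrow> 'a token list \<Rightarrow> 'a token" where
  "next_token A p T xs =
     (ARG_MAX (\<lambda>\<sigma>. dot p (dim T) (out_map T \<sigma>) (hidden p T xs (n_layers T) (length xs))) \<sigma>.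
        \<sigma> \<in> vocab A (n_extra T))"

primrec decode :: "('b list \<Rightarrow> 'b) \<Rightarrow> nat \<Rightarrow> 'b list \<Rightarrow> 'b list" where
  "decode f 0 x = x"
| "decode f (Suc k) x = (let y = decode f k x in y @ [f y])"


subsection \<open>Log-precision transformers\<close>

text \<open>
  All parameters except the projection matrices \<open>att_proj\<close> and \<open>ff_proj\<close>, which may be arbitrary
  real matrices, are required to be representable.
\<close>

definition head_in :: "nat \<Rightarrow> 'a transformer \<Rightarrow> head_params \<Rightarrow> bool" where
  "head_in p T P \<longleftrightarrow>
     (let m = dim T; dh = head_dim T
      in mat_in p dh m (wq P) \<and> vec_in p dh (bq P) \<and>
         mat_in p dh m (wk P) \<and> vec_in p dh (bk P) \<and>
         mat_in p dh m (wu P) \<and> vec_in p dh (bu P))"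

definition layer_in :: "nat \<Rightarrow> 'a transformer \<Rightarrow> layer_params \<Rightarrow> bool" where
  "layer_in p T P \<longleftrightarrow>
     (let m = dim T; w = ff_width T
      in (\<forall>k < n_heads T. head_in p T (att_heads P k)) \<and>
         mat_in p m m (wo P) \<and> vec_in p m (bo P) \<and>
         mat_in p w m (w1 P) \<and> vec_in p w (b1 P) \<and>
         mat_in p m w (w2 P) \<and> vec_in p m (b2 P))"

definition params_in :: "'a set \<Rightarrow> nat \<Rightarrow> 'a transformer \<Rightarrow> bool" where
  "params_in A p T \<longleftrightarrow>
     (\<forall>\<sigma> \<in> vocab A (n_extra T). vec_in p (dim T) (emb T \<sigma>) \<and> vec_in p (dim T) (out_map T \<sigma>)) \<and>
     (\<forall>l < n_layers T. layer_in p T (layers T l))"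

text \<open>
  \<open>n\<close> ranges over the lengths of (nonempty) inputs, \<open>t n\<close> is the number of decoding steps and
  \<open>p n\<close> the precision used on inputs of length \<open>n\<close>. The parameters in \<open>T\<close> do not depend on \<open>n\<close>.
  Tokens are read at positions below \<open>n + t n\<close> only.
\<close>

definition log_precision_transformer ::
  "'a set \<Rightarrow> (nat \<Rightarrow> nat) \<Rightarrow> (nat \<Rightarrow> nat) \<Rightarrow> 'a transformer \<Rightarrow> bool" where
  "log_precision_transformer A t p T \<longleftrightarrow>
     0 < n_heads T \<and> 0 < dim T \<and> n_heads T dvd dim T \<and>
     log_time_computable (dim T) (pos_enc T) \<and>
     (\<exists>c :: real. \<forall>n\<ge>1. real (p n) \<le> c * log 2 (real (n + t n))) \<and>
     (\<forall>n\<ge>1. params_in A (p n) T \<and> (\<forall>i \<in> {1..<n + t n}. vec_in (p n) (dim T) (pos_enc T i)))"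

definition no_pos_enc :: "'a transformer \<Rightarrow> bool" where
  "no_pos_enc T \<longleftrightarrow> (\<forall>i. \<forall>c < dim T. pos_enc T i c = 0)"

text \<open>On \<open>$x\<close>, of length \<open>length x + 1\<close>, the last token generated in \<open>length x + 1\<close> steps decides.\<close>

definition checks_language ::
  "'a set \<Rightarrow> (nat \<Rightarrow> nat) \<Rightarrow> 'a transformer \<Rightarrow> 'a list set \<Rightarrow> bool" where
  "checks_language A p T L \<longleftrightarrow>
     (\<forall>x \<in> lists A.
        last (decode (next_token A (p (length x + 1)) T) (length x + 1) (Bos # map Input x)) = Accept
        \<longleftrightarrow> x \<in> L)"

end

theory Submission
  imports Defs
begin

text \<open>
  The generated tokens are the states of the automaton: the first one is the initial state, and the
  next token after the \<open>k\<close>-th one is computed from that state and the \<open>k\<close>-th letter. To fetch the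
  letter without positional encodings, the first layer averages over all preceding tokens. This
  yields \<open>1 / N\<close> (the fraction of \<open>Bos\<close>) and \<open>k / N\<close> (the fraction of non-input tokens, where \<open>N\<close> is
  the number of preceding tokens). After normalization, a position with \<open>j\<close> predecessors has a key in
  direction \<open>(1, j)\<close> and the current position has a query in direction \<open>(1, k)\<close>, so that the second
  layer attends exactly to \<open>j = k\<close>. Logarithmic precision suffices for this because the
  gap between the best and the second best score is inversely polynomial. The last step is
  recognized by the numbers of input and non-input tokens among the preceding ones being equal.
\<close>

text \<open>The obstacle is that a score compares keys of different positions, whereas every vector
  is read only after division by a norm that varies with the position. The fetching layer normalizes
  \<open>(1, 1, a, c)\<close>, the two ones being the own token and the constant. At a letter with
  \<open>j\<close> predecessors, \<open>Bos\<close> is the only non-input token before it, so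
  \<open>a = c = 1 / j\<close>, and the key \<open>(1 / j, 1)\<close> divided by
  \<open>sqrt (4 + 4 / j^2)\<close> is half the unit vector in direction \<open>(1, j)\<close>. At
  generated tokens \<open>c \<ge> a\<close>, so the norm can only grow and the score only drop; a
  sharp norm is needed at letters alone. The norm of the query is a common factor of all scores.

  Only this comparison needs error analysis, and nine factors \<open>eta\<close> separate its two
  sides. The rest is exact or rests on constant bounds: selections have one sign per row,
  monotonicity of truncation makes ReLU inputs nonpositive exactly where a unit must be off, and
  normalizing the tiny difference \<open>d\<close> on its own turns its positivity into a number of
  constant size.\<close>

section \<open>Rounding\<close>

lemma floatsI:
  assumes "a + b + 2 \<le> p" "\<bar>m\<bar> < 2 ^ a" "\<bar>e\<bar> < 2 ^ b"
  shows "of_int m * 2 powi e \<in> floats p"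
  using assms unfolding floats_def by blast

text \<open>\<open>trunc\<close> takes a \<open>Max\<close>, which has the intended meaning on
  finite sets only.\<close>

lemma finite_floats [simp]: "finite (floats p)"
proof -
  have "floats p \<subseteq> (\<lambda>(m, e). of_int m * 2 powi e) ` ({- (2 ^ p)..2 ^ p} \<times> {- (2 ^ p)..2 ^ p})"
  proof
    fix x assume "x \<in> floats p"
    then obtain m e :: int and a b :: nat where x: "x = of_int m * 2 powi e"
      and ab: "a + b + 2 \<le> p" "\<bar>m\<bar> < 2 ^ a" "\<bar>e\<bar> < 2 ^ b"
      unfolding floats_def by blast
    have "(2::int) ^ a \<le> 2 ^ p" "(2::int) ^ b \<le> 2 ^ p"
      using ab(1) by (auto intro!: power_increasing)
    with ab(2,3) have "m \<in> {- (2 ^ p)..2 ^ p}" "e \<in> {- (2 ^ p)..2 ^ p}" by (simp_all, linarith+)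
    with x show "x \<in> (\<lambda>(m, e). of_int m * 2 powi e) ` ({- (2 ^ p)..2 ^ p} \<times> {- (2 ^ p)..2 ^ p})"
      by auto
  qed
  then show ?thesis by (rule finite_subset) auto
qed

lemma floats_uminus [simp]: "- x \<in> floats p \<longleftrightarrow> x \<in> floats p"
proof -
  have *: "- y \<in> floats p" if y: "y \<in> floats p" for y
  proof -
    from y obtain m e :: int and a b :: nat where "y = of_int m * 2 powi e"
      and ab: "a + b + 2 \<le> p" "\<bar>m\<bar> < 2 ^ a" "\<bar>e\<bar> < 2 ^ b"
      unfolding floats_def by blast
    then have "- y = of_int (- m) * 2 powi e" by simp
    moreover have "of_int (- m) * 2 powi e \<in> floats p" using ab by (intro floatsI) auto
    ultimately show ?thesis by metis
  qed
  from *[of x] *[of "- x"] show ?thesis by auto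
qed

text \<open>
  Mantissa and exponent both get \<open>s\<close> bits. Positive reals in \<open>[2 ^ -s, 2 ^ s]\<close> then stay clear of
  the exponent range, and rounding them loses at most the factor \<open>eta\<close>.
\<close>

locale float_format =
  fixes s p :: nat
  assumes s_ge: "10 \<le> s" and p_def: "p = 2 * s + 2"
begin

abbreviation "tr \<equiv> trunc p"

definition eta :: real where "eta = 1 - 2 / 2 ^ s"

lemma of_int_floats: "\<bar>m\<bar> < 2 ^ s \<Longrightarrow> of_int m \<in> floats p"
  using floatsI[of s s p m 0] p_def by simp

lemma small_pow: "(1024::real) \<le> 2 ^ s"
proof -
  have "(2::real) ^ 10 \<le> 2 ^ s" using s_ge by (intro power_increasing) auto
  then show ?thesis by simp
qed

lemma eta_bounds: "99/100 \<le> eta" "eta \<le> 1"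
  using small_pow by (auto simp: eta_def field_simps)

lemma floats_simps [simp]:
  "0 \<in> floats p" "1 \<in> floats p" "2 \<in> floats p" "4 \<in> floats p" "8 \<in> floats p"
proof -
  have s: "(1024::int) \<le> 2 ^ s"
    using small_pow by (metis of_int_le_iff of_int_numeral of_int_power)
  show "0 \<in> floats p" "1 \<in> floats p" "2 \<in> floats p" "4 \<in> floats p" "8 \<in> floats p"
    using s of_int_floats[of 0] of_int_floats[of 1] of_int_floats[of 2] of_int_floats[of 4]
      of_int_floats[of 8] by auto
qed

lemma floats_powi [simp]: "k \<le> 9 \<Longrightarrow> 1 / 2 ^ k \<in> floats p"
proof -
  assume k: "k \<le> 9"
  have "1 < (2::int) ^ s" using s_ge by simp
  have "real k < 2 ^ s" using k small_pow by linarith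
  then have "k < 2 ^ s" by (metis of_nat_less_iff of_nat_numeral of_nat_power)
  then have "int k < 2 ^ s" by (metis of_nat_less_iff of_nat_numeral of_nat_power)
  with \<open>1 < 2 ^ s\<close> have "of_int 1 * 2 powi (- int k) \<in> floats p"
    by (intro floatsI[of s s]) (auto simp: p_def)
  then show ?thesis by (simp add: power_int_minus field_simps)
qed

lemma floats_half [simp]: "1/2 \<in> floats p" "1/4 \<in> floats p" "1/16 \<in> floats p"
  using floats_powi[of 1] floats_powi[of 2] floats_powi[of 4] by simp_all

section \<open>Truncation: monotonicity and relative error\<close>

definition below :: "real \<Rightarrow> real set" where
  "below x = {y \<in> floats p. 0 \<le> y \<and> y \<le> x}"

lemma below_props:
  assumes "0 \<le> x"
  shows "finite (below x)" "0 \<in> below x" "Max (below x) \<in> below x"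
proof -
  show fin: "finite (below x)" unfolding below_def by simp
  show z: "0 \<in> below x" unfolding below_def using assms by simp
  show "Max (below x) \<in> below x" using fin z by (intro Max_in) auto
qed

lemma tr_nonneg_eq: "0 \<le> x \<Longrightarrow> tr x = Max (below x)"
proof (cases "x = 0")
  case True
  have "Max (below 0) = y \<Longrightarrow> y = 0" for y using below_props(3)[of 0] by (auto simp: below_def)
  with True show ?thesis by (simp add: trunc_def)
qed (auto simp: trunc_def below_def)

lemma tr_minus: "tr (- x) = - tr x"
  by (simp add: trunc_def sgn_minus)

lemma tr_nonneg: assumes "0 \<le> x" shows "tr x \<in> floats p" "0 \<le> tr x" "tr x \<le> x"
  using below_props(3)[OF assms] tr_nonneg_eq[OF assms] unfolding below_def by auto

lemma tr_greatest: assumes "y \<in> floats p" "0 \<le> y" "y \<le> x" shows "y \<le> tr x"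
proof -
  have "y \<in> below x" "0 \<le> x" using assms by (auto simp: below_def)
  then show ?thesis using tr_nonneg_eq below_props(1) by (metis Max_ge)
qed

lemma tr_floats [simp]: "tr x \<in> floats p"
  using tr_nonneg(1)[of x] tr_nonneg(1)[of "- x"] by (cases "0 \<le> x") (auto simp: tr_minus)

lemma tr_id [simp]: assumes "x \<in> floats p" shows "tr x = x"
proof -
  have *: "tr y = y" if "y \<in> floats p" "0 \<le> y" for y
    using tr_greatest[of y y] tr_nonneg(3)[of y] that by auto
  show ?thesis using *[of x] *[of "- x"] assms by (cases "0 \<le> x") (auto simp: tr_minus)
qed

lemma tr_0 [simp]: "tr 0 = 0" by simp

lemma tr_mono: assumes "x \<le> y" shows "tr x \<le> tr y"
proof -
  have *: "tr u \<le> tr v" if "0 \<le> u" "u \<le> v" for u v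
    using that tr_nonneg[of u] by (intro tr_greatest) auto
  consider "0 \<le> x" | "x < 0" "0 \<le> y" | "y < 0" using assms by linarith
  then show ?thesis
  proof cases
    case 2
    then show ?thesis using tr_nonneg(2)[of y] tr_nonneg(2)[of "- x"] by (auto simp: tr_minus)
  next
    case 3
    then show ?thesis using *[of "- y" "- x"] assms by (auto simp: tr_minus)
  qed (use * assms in auto)
qed

text \<open>Representable bounds survive rounding without any loss. Wherever a constant bound is
  enough, this and \<open>tr_le\<close> replace the relative error \<open>eta\<close>.\<close>

lemma tr_ge: "y \<in> floats p \<Longrightarrow> y \<le> x \<Longrightarrow> y \<le> tr x"
  using tr_mono[of y x] by simp

lemma tr_le: "y \<in> floats p \<Longrightarrow> x \<le> y \<Longrightarrow> tr x \<le> y"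
  using tr_mono[of x y] by simp

text \<open>The exponent is chosen so that the mantissa uses all \<open>s\<close> bits: the floor
  discards less than 1 from a number that is at least \<open>2 ^ s / 2\<close>.\<close>

lemma tr_rel:
  assumes "1 / 2 ^ s \<le> x" "x \<le> 2 ^ s"
  shows "eta * x \<le> tr x"
proof -
  have x: "0 < x" using assms(1) by (smt (verit) zero_less_divide_1_iff zero_less_power)
  define k where "k = \<lfloor>log 2 x\<rfloor>"
  define e where "e = k - int s + 1"
  define m where "m = \<lfloor>x / 2 powi e\<rfloor>"
  have k1: "2 powi k \<le> x" and k2: "x < 2 powi (k + 1)"
    using x floor_log_eq_powr_iff[of x 2 k] powr_real_of_int'[of 2 k] powr_real_of_int'[of 2 "k + 1"]
    unfolding k_def by auto
  have kl: "- int s \<le> k"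
  proof -
    have "log 2 (1 / 2 ^ s) \<le> log 2 x" using assms x by (subst log_le_cancel_iff) auto
    moreover have "log 2 (1 / 2 ^ s) = - real s" by (simp add: log_divide)
    ultimately show ?thesis unfolding k_def by linarith
  qed
  have ku: "k \<le> int s"
  proof -
    have "log 2 x \<le> log 2 (2 ^ s)" using assms x by (subst log_le_cancel_iff) auto
    then show ?thesis unfolding k_def by simp linarith
  qed
  have pos: "(0::real) < 2 powi e" by simp
  have ub: "x / 2 powi e < 2 ^ s"
  proof -
    have "(2::real) powi (k + 1) = 2 ^ s * 2 powi e"
      using power_int_add[of "2::real" "int s" e] by (simp add: e_def add.commute)
    then show ?thesis using k2 pos by (simp add: field_simps)
  qed
  have lb: "2 ^ s / 2 \<le> x / 2 powi e"
  proof -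
    have "(2::real) powi (k + 1) = 2 ^ s * 2 powi e"
      using power_int_add[of "2::real" "int s" e] by (simp add: e_def add.commute)
    moreover have "(2::real) powi (k + 1) = 2 powi k * 2" by (simp add: power_int_add)
    ultimately show ?thesis using k1 pos by (simp add: field_simps)
  qed
  have m0: "0 \<le> m" unfolding m_def using x pos by simp
  have "real_of_int m < 2 ^ s" unfolding m_def using ub by linarith
  then have m1: "\<bar>m\<bar> < 2 ^ s" using m0 by (metis abs_of_nonneg of_int_less_iff of_int_numeral of_int_power)
  \<comment> \<open>Since \<open>k\<close> lies between \<open>- s\<close> and \<open>s\<close>, the
    absolute value of \<open>e = k - s + 1\<close> is at most \<open>2 * s\<close>; this has to fit
    into \<open>s\<close> bits.\<close>
  have "2 * s < 2 ^ s" using s_ge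
  proof (induction s rule: dec_induct)
    case (step n) then show ?case by simp
  qed simp
  then have e1: "\<bar>e\<bar> < 2 ^ s"
  proof -
    assume "2 * s < 2 ^ s"
    then have "int (2 * s) < 2 ^ s" by (metis of_nat_less_iff of_nat_numeral of_nat_power)
    then show ?thesis using kl ku s_ge unfolding e_def by linarith
  qed
  have y: "of_int m * 2 powi e \<in> floats p" using m1 e1 by (intro floatsI[of s s]) (auto simp: p_def)
  have yx: "of_int m * 2 powi e \<le> x"
    unfolding m_def using pos by (metis floor_le_iff le_floor_iff mult.commute mult_le_cancel_right of_int_floor_le pos_le_divide_eq)
  have "eta * (x / 2 powi e) \<le> x / 2 powi e - 1"
  proof -
    have "1 \<le> (2 / 2 ^ s) * (x / 2 powi e)" using lb
      by (simp add: field_simps)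
    then show ?thesis unfolding eta_def by (simp add: algebra_simps)
  qed
  also have "\<dots> \<le> m" unfolding m_def by linarith
  finally have "eta * x \<le> of_int m * 2 powi e" using pos by (simp add: field_simps)
  also have "\<dots> \<le> tr x" using y yx m0 by (intro tr_greatest) auto
  finally show ?thesis .
qed

end

section \<open>Linear maps and projected pre-norm\<close>

lemma sum_single:
  fixes f :: "nat \<Rightarrow> real"
  assumes "j < n" "\<And>i. i < n \<Longrightarrow> i \<noteq> j \<Longrightarrow> f i = 0"
  shows "(\<Sum>i<n. f i) = f j"
proof -
  have "(\<Sum>i<n. f i) = (\<Sum>i\<in>{j}. f i)" using assms by (intro sum.mono_neutral_right) auto
  then show ?thesis by simp
qed

definition sel_mat :: "nat \<Rightarrow> nat set \<Rightarrow> rmat" where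
  "sel_mat H K i j =
     (if i < H then of_bool (j = i \<and> i \<in> K) else - of_bool (j = i - H \<and> j \<in> K))"

definition id_mat :: rmat where
  "id_mat i j = of_bool (i = j)"

context float_format
begin

lemma dot_single:
  assumes "j < n" "\<And>i. i < n \<Longrightarrow> i \<noteq> j \<Longrightarrow> x i * y i = 0"
  shows "dot p n x y = tr (x j * y j)"
  unfolding dot_def using sum_single[of j n "\<lambda>i. tr (x i * y i)"] assms by simp

lemma dot_zero: "(\<And>i. i < n \<Longrightarrow> x i * y i = 0) \<Longrightarrow> dot p n x y = 0"
  unfolding dot_def by (metis (no_types, lifting) lessThan_iff sum.neutral tr_0)

lemma dot_two:
  assumes "j < n" "k < n" "j \<noteq> k" "\<And>i. i < n \<Longrightarrow> i \<noteq> j \<Longrightarrow> i \<noteq> k \<Longrightarrow> x i * y i = 0"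
  shows "dot p n x y = tr (tr (x j * y j) + tr (x k * y k))"
proof -
  have "(\<Sum>i<n. tr (x i * y i)) = (\<Sum>i\<in>{j, k}. tr (x i * y i))"
    using assms(1,2) by (intro sum.mono_neutral_right ballI) (auto simp del: mult_eq_0_iff simp: assms(4))
  then show ?thesis using assms(3) unfolding dot_def by simp
qed

lemma dot_floats [simp]: "dot p n x y \<in> floats p"
  by (simp add: dot_def)

lemma affine_zero_bias: "affine p n W (\<lambda>_. 0) x i = dot p n (W i) x"
  by (simp add: affine_def vadd_def matvec_def)

lemma matvec_id: "x i \<in> floats p \<Longrightarrow> matvec p n id_mat x i = (if i < n then x i else 0)"
  unfolding matvec_def using dot_single[of i n "id_mat i" x] dot_zero[of n "id_mat i" x]
  by (auto simp: id_mat_def)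

text \<open>Every row has at most one nonzero entry, a sign, so the product involves no rounding at
  all.\<close>

lemma matvec_sel:
  assumes "K \<subseteq> {..<H}" "\<And>j. j \<in> K \<Longrightarrow> v j \<in> floats p" "i < 2 * H"
  shows "matvec p (2 * H) (sel_mat H K) v i =
           (if i < H then (if i \<in> K then v i else 0) else (if i - H \<in> K then - v (i - H) else 0))"
proof (cases "i < H")
  case True
  then show ?thesis unfolding matvec_def
    using assms dot_single[of i "2 * H" "sel_mat H K i" v] by (auto simp: sel_mat_def)
next
  case False
  then show ?thesis unfolding matvec_def
    using assms dot_single[of "i - H" "2 * H" "sel_mat H K i" v] by (auto simp: sel_mat_def)
qed

text \<open>The factor 2 arises because each selected coordinate occurs a second time with opposite
  sign.\<close>

definition sel_norm :: "nat set \<Rightarrow> rvec \<Rightarrow> real" where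
  "sel_norm K v = tr (sqrt (tr (2 * (\<Sum>i\<in>K. tr (v i * v i)))))"

text \<open>Appending the negated selection makes the mean vanish, so that no rounding error arises from it.\<close>

lemma proj_norm_sel:
  assumes K: "K \<subseteq> {..<H}" and fl: "\<And>j. j \<in> K \<Longrightarrow> v j \<in> floats p" and i: "i < H"
  shows "proj_norm p (2 * H) (sel_mat H K) v i =
           (if i \<in> K \<and> (\<exists>j\<in>K. v j \<noteq> 0) then tr (v i / sel_norm K v) else 0)"
proof -
  define x where "x = matvec p (2 * H) (sel_mat H K) v"
  have x: "x i = (if i < H then (if i \<in> K then v i else 0) else (if i - H \<in> K then - v (i - H) else 0))"
    if "i < 2 * H" for i
    unfolding x_def using matvec_sel[OF K fl that] by simp
  have split: "(\<Sum>i<2 * H. f i) = (\<Sum>i<H. f i) + (\<Sum>i<H. f (i + H))" for f :: "nat \<Rightarrow> real"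
  proof -
    have "(\<Sum>i<2 * H. f i) = sum f {0..<H} + sum f {H..<2 * H}"
      by (simp add: sum.atLeastLessThan_concat lessThan_atLeast0)
    also have "sum f {H..<2 * H} = sum f {0 + H..<H + H}" by (simp add: mult_2)
    also have "\<dots> = (\<Sum>i = 0..<H. f (i + H))" by (rule sum.shift_bounds_nat_ivl)
    finally show ?thesis by (simp add: lessThan_atLeast0)
  qed
  have restr: "(\<Sum>i<H. if i \<in> K then f i else 0) = sum f K" for f :: "nat \<Rightarrow> real"
    using K by (subst sum.inter_restrict[symmetric]) (auto intro!: sum.cong)
  have "(\<Sum>i<2 * H. x i) = 0"
    using x unfolding split sum.distrib[symmetric] by (intro sum.neutral) auto
  then have c: "centered p (2 * H) x = (\<lambda>i. tr (x i))"
    unfolding centered_def by simp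
  have xfl: "x i \<in> floats p" if "i < 2 * H" for i
    using x[OF that] fl by auto
  have "(\<Sum>i<2 * H. tr (tr (x i) * tr (x i))) = (\<Sum>i<2 * H. tr (x i * x i))"
    using xfl by (intro sum.cong) auto
  also have "\<dots> = (\<Sum>i<H. if i \<in> K then 2 * tr (v i * v i) else 0)"
    using x unfolding split by (auto simp: sum.distrib[symmetric] intro!: sum.cong)
  also have "\<dots> = 2 * (\<Sum>i\<in>K. tr (v i * v i))"
    unfolding restr by (simp add: sum_distrib_left)
  finally have nrm: "tr (sqrt (dot p (2 * H) (centered p (2 * H) x) (centered p (2 * H) x))) = sel_norm K v"
    unfolding dot_def c sel_norm_def by simp
  have zero: "(\<forall>i<2 * H. tr (x i) = 0) \<longleftrightarrow> (\<forall>j\<in>K. v j = 0)"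
  proof
    assume *: "\<forall>i<2 * H. tr (x i) = 0"
    show "\<forall>j\<in>K. v j = 0"
    proof
      fix j assume "j \<in> K"
      moreover from this have "j < H" using K by auto
      moreover have "tr (x j) = 0" using * \<open>j < H\<close> by simp
      ultimately show "v j = 0" using x[of j] fl[of j] by simp
    qed
  next
    assume "\<forall>j\<in>K. v j = 0"
    then show "\<forall>i<2 * H. tr (x i) = 0" using x by auto
  qed
  have "proj_norm p (2 * H) (sel_mat H K) v i =
      (if \<forall>j\<in>K. v j = 0 then 0 else tr (tr (x i) / sel_norm K v))"
    unfolding proj_norm_def x_def[symmetric] layer_norm_def Let_def c nrm[unfolded c] using zero by simp
  then show ?thesis using x[of i] xfl[of i] i by auto
qed

text \<open>With a one among the selected entries, normalization cannot enlarge entries; those in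
  \<open>[0, 1]\<close> stay there.\<close>

lemma sel_norm_ge_1:
  assumes "finite K" "j \<in> K" "v j = 1"
  shows "1 \<le> sel_norm K v"
proof -
  have "tr (v j * v j) \<le> (\<Sum>i\<in>K. tr (v i * v i))"
    using assms tr_nonneg(2) by (intro member_le_sum) auto
  then have "1 \<le> tr (2 * (\<Sum>i\<in>K. tr (v i * v i)))" using assms by (intro tr_ge) auto
  then show ?thesis unfolding sel_norm_def by (intro tr_ge) auto
qed

end

section \<open>Separation of the attention scores\<close>

text \<open>\<open>M\<close> bounds all token counts. In \<open>precise\<close>, 36 is twice the
  exponent 18 of \<open>eta\<close> in \<open>circle_gap\<close> (each factor loses
  \<open>2 / 2 ^ s\<close>), and \<open>(1 + M^2)^2\<close> bounds the inverse of the relative gap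
  between squared scores.\<close>

locale attention_precision = float_format +
  fixes M :: nat
  assumes M_ge: "1 \<le> M" and precise: "36 * (1 + (real M)\<^sup>2)\<^sup>2 < 2 ^ s"
begin

lemma M_sq: "72 * (real M)\<^sup>2 \<le> 2 ^ s" "real M \<le> 2 ^ s" "144 \<le> (2::real) ^ s"
proof -
  have m: "1 \<le> real M" using M_ge by simp
  have "1 \<le> (real M)\<^sup>2" using m by simp
  then have "(1 + (real M)\<^sup>2) * 2 \<le> (1 + (real M)\<^sup>2)\<^sup>2" unfolding power2_eq_square[of "1 + (real M)\<^sup>2"]
    by (intro mult_left_mono) auto
  then have *: "72 * (1 + (real M)\<^sup>2) \<le> 2 ^ s" using precise by linarith
  then have **: "72 + 72 * (real M)\<^sup>2 \<le> 2 ^ s" by (simp add: algebra_simps)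
  then show "72 * (real M)\<^sup>2 \<le> 2 ^ s" by simp
  have "real M \<le> (real M)\<^sup>2" using m by (simp add: power2_eq_square)
  then show "real M \<le> 2 ^ s" using ** \<open>1 \<le> (real M)\<^sup>2\<close> by linarith
  show "144 \<le> (2::real) ^ s" using ** \<open>1 \<le> (real M)\<^sup>2\<close> by linarith
qed

text \<open>The smallest numbers rounded with relative error are products of two factors of size at
  least \<open>1 / (8 * M)\<close>. Passing from 64 to 72 leaves room for a rounding that has
  already taken place.\<close>

lemma tr_relM:
  assumes "1 / (72 * (real M)\<^sup>2) \<le> x" "x \<le> 100"
  shows "eta * x \<le> tr x"
proof (rule tr_rel)
  have "1 / 2 ^ s \<le> 1 / (72 * (real M)\<^sup>2)" using M_sq(1) M_ge by (intro divide_left_mono) auto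
  then show "1 / 2 ^ s \<le> x" using assms by linarith
  show "x \<le> 2 ^ s" using assms M_sq by linarith
qed

lemma inv_le: "1 \<le> N \<Longrightarrow> N \<le> M \<Longrightarrow> 1 / (72 * (real M)\<^sup>2) \<le> 1 / (72 * (real N)\<^sup>2)"
  by (intro divide_left_mono) auto

lemma inv_sq_le: "1 \<le> N \<Longrightarrow> 1 / (72 * (real N)\<^sup>2) \<le> 1 / (72 * real N)"
  by (intro divide_left_mono) (auto simp: power2_eq_square)

text \<open>The norm computed by the fetching layer. The inner summand 2 counts the one-hot entry of
  the own token and the constant coordinate.\<close>

definition nu :: "real \<Rightarrow> real \<Rightarrow> real" where
  "nu a b = tr (sqrt (tr (2 * (2 + tr (a * a) + tr (b * b)))))"

lemma avg_bounds:
  assumes "1 \<le> c" "c \<le> N" "1 \<le> N" "N \<le> M"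
  shows "eta * (real c / real N) \<le> tr (real c / real N)" "tr (real c / real N) \<le> real c / real N"
    "1 / (2 * real N) \<le> tr (real c / real N)" "tr (real c / real N) \<le> 1"
proof -
  have a: "1 / real N \<le> real c / real N" using assms by (intro divide_right_mono) auto
  have c1: "real c / real N \<le> 1" using assms by simp
  have "1 / (72 * (real M)\<^sup>2) \<le> 1 / real N"
  proof -
    have "1 / (72 * real N) \<le> 1 / real N" using assms by (intro divide_left_mono) auto
    then show ?thesis using inv_le[of N] inv_sq_le[of N] assms by linarith
  qed
  then show 1: "eta * (real c / real N) \<le> tr (real c / real N)"
    using a c1 by (intro tr_relM) auto
  show 2: "tr (real c / real N) \<le> real c / real N" by (intro tr_nonneg) auto
  have "1/2 * (1 / real N) \<le> eta * (real c / real N)"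
    using a eta_bounds by (intro mult_mono) auto
  then show "1 / (2 * real N) \<le> tr (real c / real N)" using 1 by simp
  show "tr (real c / real N) \<le> 1" using 2 c1 by linarith
qed

text \<open>Rounding an average and then its square costs \<open>eta ^ 3\<close>, rounding the
  doubled sum makes it \<open>eta ^ 4\<close>, the root halves this to \<open>eta ^ 2\<close>, and
  the last rounding yields \<open>eta ^ 3\<close>. The lower bound treats any
  \<open>c \<ge> 1\<close> like \<open>c = 1\<close>, which suffices for competitors; the matching
  upper bound is required only of the winning key, where \<open>c = 1\<close>.\<close>

lemma nu_bounds:
  assumes "1 \<le> c" "c \<le> N" "1 \<le> N" "N \<le> M"
  defines "a \<equiv> tr (1 / real N)" and "b \<equiv> tr (real c / real N)"
  shows "1 \<le> nu a b" "nu a b \<le> 3" "eta ^ 3 * sqrt (4 + 4 / (real N)\<^sup>2) \<le> nu a b"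
    "c = 1 \<Longrightarrow> nu a b \<le> sqrt (4 + 4 / (real N)\<^sup>2)"
proof -
  have A: "eta * (1 / real N) \<le> a" "a \<le> 1 / real N" "1 / (2 * real N) \<le> a" "a \<le> 1"
    using avg_bounds[of 1 N] assms unfolding a_def by auto
  have B: "eta * (real c / real N) \<le> b" "b \<le> real c / real N" "1 / (2 * real N) \<le> b" "b \<le> 1"
    using avg_bounds[of c N] assms unfolding b_def by auto
  have B': "eta * (1 / real N) \<le> b"
  proof -
    have "eta * (1 / real N) \<le> eta * (real c / real N)"
      using eta_bounds assms by (intro mult_left_mono divide_right_mono) auto
    then show ?thesis using B by linarith
  qed
  have pos: "0 \<le> a" "0 \<le> b" unfolding a_def b_def by (auto intro: tr_nonneg)
  have sq: "eta ^ 3 * (1 / (real N)\<^sup>2) \<le> tr (x * x) \<and> tr (x * x) \<le> x * x \<and> x * x \<le> 1 \<and> 0 \<le> tr (x * x)"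
    if x: "eta * (1 / real N) \<le> x" "1 / (2 * real N) \<le> x" "x \<le> 1" "0 \<le> x" for x
  proof -
    have xx: "x * x \<le> 1" using x by (simp add: mult_le_one)
    have "1 / (2 * real N) * (1 / (2 * real N)) \<le> x * x" using x by (intro mult_mono) auto
    moreover have "1 / (72 * (real N)\<^sup>2) \<le> 1 / (2 * real N) * (1 / (2 * real N))"
      using assms by (simp add: field_simps power2_eq_square)
    ultimately have "eta * (x * x) \<le> tr (x * x)" using xx inv_le[of N] assms by (intro tr_relM) auto
    moreover have "eta * (1 / real N) * (eta * (1 / real N)) \<le> x * x"
      using x eta_bounds by (intro mult_mono) auto
    then have "eta * (eta * (1 / real N) * (eta * (1 / real N))) \<le> eta * (x * x)"
      using eta_bounds by (intro mult_left_mono) auto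
    moreover have "eta * (eta * (1 / real N) * (eta * (1 / real N))) = eta ^ 3 * (1 / (real N)\<^sup>2)"
      by (simp add: power2_eq_square power3_eq_cube)
    ultimately show ?thesis using xx tr_nonneg[of "x * x"] x by auto
  qed
  note sa = sq[OF A(1,3,4) pos(1)] and sb = sq[OF B' B(3,4) pos(2)]
  define S where "S = 2 * (2 + tr (a * a) + tr (b * b))"
  have S: "4 \<le> S" "S \<le> 8" using sa sb unfolding S_def by auto
  have eta3: "eta ^ 3 \<le> 1" using eta_bounds by (intro power_le_one) auto
  have "4 * eta ^ 3 + 4 * (eta ^ 3 * (1 / (real N)\<^sup>2)) \<le> S"
  proof -
    have "4 * y + 4 * u \<le> 2 * (2 + A + B)" if "u \<le> A" "u \<le> B" "y \<le> 1" for u y A B :: real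
      using that by (simp add: algebra_simps)
    then show ?thesis using sa sb eta3 unfolding S_def by blast
  qed
  then have Sl: "eta ^ 3 * (4 + 4 / (real N)\<^sup>2) \<le> S" by (simp add: algebra_simps)
  have tS: "eta * S \<le> tr S"
  proof (rule tr_relM)
    have "1 / (72 * (real M)\<^sup>2) \<le> 1 / 72" using M_ge by (simp add: field_simps)
    then show "1 / (72 * (real M)\<^sup>2) \<le> S" using S by linarith
  qed (use S in auto)
  have tS2: "4 \<le> tr S" "tr S \<le> S" "tr S \<le> 8" using S tr_ge[of 4 S] tr_nonneg(3)[of S] by auto
  have sq1: "2 \<le> sqrt (tr S)" "sqrt (tr S) \<le> 3"
    using tS2 real_sqrt_le_mono[of 4 "tr S"] real_sqrt_le_mono[of "tr S" 9] by auto
  have nu: "nu a b = tr (sqrt (tr S))" unfolding nu_def S_def by simp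
  show "1 \<le> nu a b" unfolding nu using sq1(1) by (intro tr_ge[OF floats_simps(2)]) linarith
  show "nu a b \<le> 3" unfolding nu using sq1 tr_nonneg(3)[of "sqrt (tr S)"] by linarith
  have "eta * (eta ^ 3 * (4 + 4 / (real N)\<^sup>2)) \<le> eta * S"
    using Sl eta_bounds by (intro mult_left_mono) auto
  then have "(eta ^ 2)\<^sup>2 * (4 + 4 / (real N)\<^sup>2) \<le> tr S" using tS by (simp add: power_numeral_reduce)
  then have "sqrt ((eta ^ 2)\<^sup>2 * (4 + 4 / (real N)\<^sup>2)) \<le> sqrt (tr S)" by simp
  then have "eta ^ 2 * sqrt (4 + 4 / (real N)\<^sup>2) \<le> sqrt (tr S)"
    unfolding real_sqrt_mult using eta_bounds by (simp only: real_sqrt_abs) simp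
  then have "eta * (eta ^ 2 * sqrt (4 + 4 / (real N)\<^sup>2)) \<le> eta * sqrt (tr S)"
    using eta_bounds by (intro mult_left_mono) auto
  moreover have "eta * sqrt (tr S) \<le> tr (sqrt (tr S))"
  proof (rule tr_relM)
    have "1 / (72 * (real M)\<^sup>2) \<le> 1 / 72" using M_ge by (simp add: field_simps)
    then show "1 / (72 * (real M)\<^sup>2) \<le> sqrt (tr S)" using sq1 by linarith
  qed (use sq1 in auto)
  ultimately show "eta ^ 3 * sqrt (4 + 4 / (real N)\<^sup>2) \<le> nu a b"
    unfolding nu by (simp add: power_numeral_reduce)
  show "nu a b \<le> sqrt (4 + 4 / (real N)\<^sup>2)" if "c = 1"
  proof -
    have ab: "a = b" unfolding a_def b_def using that by simp
    have "a * a \<le> 1 / real N * (1 / real N)" using A pos by (intro mult_mono) auto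
    then have "S \<le> 4 + 4 / (real N)\<^sup>2" using sa unfolding S_def ab
      by (simp add: power2_eq_square)
    then have "sqrt (tr S) \<le> sqrt (4 + 4 / (real N)\<^sup>2)" using tS2 by simp
    then show ?thesis unfolding nu using tr_nonneg(3)[of "sqrt (tr S)"] sq1 by linarith
  qed
qed

definition score :: "real \<Rightarrow> real \<Rightarrow> real \<Rightarrow> real \<Rightarrow> real" where
  "score q0 q1 k0 k1 = tr (tr (q0 * k0) + tr (q1 * k1))"

text \<open>
  Up to rounding, the key at position \<open>j + 1\<close> is a multiple of the unit vector in direction
  \<open>(1, j)\<close>, the query is a multiple of \<open>(1, k)\<close>, and Cauchy-Schwarz is strict for \<open>j \<noteq> k\<close>. For
  integers the gap is at least of order \<open>1 / (j\<^sup>2 * k\<^sup>2)\<close>, which dominates the rounding errors.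
\<close>

lemma circle_gap:
  fixes j k :: nat
  assumes "j \<noteq> k" "1 \<le> j" "j \<le> M" "1 \<le> k" "k \<le> M"
  shows "(1 / real j + real k) / (eta ^ 3 * sqrt (4 + 4 / (real j)\<^sup>2))
       < eta ^ 6 * ((1 / real k + real k) / sqrt (4 + 4 / (real k)\<^sup>2))"
proof -
  define P where "P = (1 + (real j)\<^sup>2) * (1 + (real k)\<^sup>2)"
  have e0: "0 < eta" "eta \<le> 1" using eta_bounds by auto
  have S: "(1 / real i + real k) / sqrt (4 + 4 / (real i)\<^sup>2) = (1 + real k * real i) / (2 * sqrt (1 + (real i)\<^sup>2))"
    if "1 \<le> i" for i :: nat
  proof -
    have i: "0 < real i" using that by simp
    have "4 + 4 / (real i)\<^sup>2 = (2 / real i)\<^sup>2 * (1 + (real i)\<^sup>2)"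
      using i by (simp add: field_simps power2_eq_square)
    then have "sqrt (4 + 4 / (real i)\<^sup>2) = 2 / real i * sqrt (1 + (real i)\<^sup>2)"
      using i by (simp add: real_sqrt_mult)
    then show ?thesis using i by (simp add: field_simps)
  qed
  \<comment> \<open>Lagrange's identity: the defect in Cauchy-Schwarz is the square of a nonzero
    integer, hence at least 1.\<close>
  have P: "P = (1 + real k * real j)\<^sup>2 + (real k - real j)\<^sup>2"
    unfolding P_def by (simp add: power2_eq_square algebra_simps)
  have gap: "1 \<le> (real k - real j)\<^sup>2"
  proof -
    have "1 \<le> \<bar>real k - real j\<bar>" using assms(1) by linarith
    then show ?thesis by (simp add: abs_le_square_iff[of 1, simplified])
  qed
  have PM: "P \<le> (1 + (real M)\<^sup>2)\<^sup>2"
    unfolding P_def power2_eq_square[of "1 + (real M)\<^sup>2"] using assms by (intro mult_mono) auto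
  \<comment> \<open>Three factors \<open>eta\<close> on the left and six on the right make nine;
    squaring doubles them.\<close>
  have "1 - 18 * (2 / 2 ^ s) \<le> eta ^ 18"
  proof -
    have "1 + real 18 * (- (2 / 2 ^ s)) \<le> (1 + - (2 / 2 ^ s)) ^ 18"
      using small_pow by (intro Bernoulli_inequality) (simp add: field_simps)
    then show ?thesis unfolding eta_def by simp
  qed
  then have "(1 - 18 * (2 / 2 ^ s)) * P \<le> eta ^ 18 * P" unfolding P_def by (intro mult_right_mono) auto
  moreover have "18 * (2 / 2 ^ s) * P < 1"
  proof -
    have "36 * P < 2 ^ s" using PM precise by linarith
    then show ?thesis by (simp add: field_simps)
  qed
  ultimately have "(1 + real k * real j)\<^sup>2 < eta ^ 18 * P"
    using P gap by (simp add: algebra_simps)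
  also have "eta ^ 18 * P = (eta ^ 9 * (sqrt (1 + (real j)\<^sup>2) * sqrt (1 + (real k)\<^sup>2)))\<^sup>2"
    unfolding P_def by (simp add: power_mult_distrib flip: power_mult)
  finally have main: "1 + real k * real j < eta ^ 9 * (sqrt (1 + (real j)\<^sup>2) * sqrt (1 + (real k)\<^sup>2))"
    by (rule power_less_imp_less_base) (use e0 in auto)
  have sj: "0 < sqrt (1 + (real j)\<^sup>2)" by (simp add: add_pos_nonneg)
  have sk: "(1 + real k * real k) / (2 * sqrt (1 + (real k)\<^sup>2)) = sqrt (1 + (real k)\<^sup>2) / 2"
  proof -
    have "1 + real k * real k = sqrt (1 + (real k)\<^sup>2) * sqrt (1 + (real k)\<^sup>2)" by (simp add: power2_eq_square)
    moreover have "0 < sqrt (1 + (real k)\<^sup>2)" by (simp add: add_pos_nonneg)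
    ultimately show ?thesis by (simp add: field_simps)
  qed
  have "(1 + real k * real j) / (2 * sqrt (1 + (real j)\<^sup>2)) < eta ^ 9 * (sqrt (1 + (real k)\<^sup>2) / 2)"
    using main sj by (simp add: field_simps)
  also have "\<dots> = eta ^ 3 * (eta ^ 6 * (sqrt (1 + (real k)\<^sup>2) / 2))" by (simp flip: power_add mult.assoc)
  finally have "(1 + real k * real j) / (2 * sqrt (1 + (real j)\<^sup>2)) / eta ^ 3
      < eta ^ 6 * (sqrt (1 + (real k)\<^sup>2) / 2)"
    using e0 by (subst pos_divide_less_eq) (auto simp: mult.commute)
  then have "(1 / real j + real k) / sqrt (4 + 4 / (real j)\<^sup>2) / eta ^ 3
      < eta ^ 6 * ((1 / real k + real k) / sqrt (4 + 4 / (real k)\<^sup>2))"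
    unfolding S[OF assms(2)] S[OF assms(4)] sk .
  then show ?thesis by (simp add: mult.commute)
qed

text \<open>The competitor's score is bounded from above for free, as truncation only decreases; its
  one loss is the \<open>eta ^ 3\<close> in the norm it is divided by. The winner loses
  \<open>eta ^ 2\<close> in the query and \<open>eta ^ 2\<close> in the key (average and quotient),
  then one factor in the products and one in the sum. \<open>circle_gap\<close> absorbs exactly
  these nine. Positivity of the winner serves the comparison with \<open>Bos\<close>, whose score is
  0.\<close>

lemma score_less:
  fixes j k N c :: nat
  assumes j: "j \<noteq> k" "1 \<le> j" "j \<le> M" and k: "1 \<le> k" "k \<le> N" and N: "N \<le> M"
    and c: "1 \<le> c" "c \<le> j"
  defines "nu_i \<equiv> nu (tr (1 / real N)) (tr (real k / real N))"
    and "nu_j \<equiv> nu (tr (1 / real j)) (tr (real c / real j))"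
    and "nu_k \<equiv> nu (tr (1 / real k)) (tr (1 / real k))"
  defines "q0 \<equiv> tr (tr (1 / real N) / nu_i)" and "q1 \<equiv> tr (tr (real k / real N) / nu_i)"
  shows "score q0 q1 (tr (tr (1 / real j) / nu_j)) (tr (1 / nu_j))
       < score q0 q1 (tr (tr (1 / real k) / nu_k)) (tr (1 / nu_k))"
    (is "?L < ?R")
    and "0 < score q0 q1 (tr (tr (1 / real k) / nu_k)) (tr (1 / nu_k))"
proof -
  have N1: "1 \<le> N" using k by simp
  have kM: "k \<le> M" using k N by simp
  have e0: "0 < eta" "eta \<le> 1" "99/100 \<le> eta" using eta_bounds by auto
  note nui = nu_bounds(1,2)[OF k N1 N, folded nu_i_def]
  note nuj = nu_bounds(1-3)[OF c j(2,3), folded nu_j_def]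
  have nuk: "1 \<le> nu_k" "nu_k \<le> 3" "nu_k \<le> sqrt (4 + 4 / (real k)\<^sup>2)"
    using nu_bounds[of 1 k] k kM unfolding nu_k_def by auto
  \<comment> \<open>Dividing by a norm of at most 3 and estimating \<open>eta\<close> by
    \<open>3/4\<close> turns \<open>1 / (2 * L)\<close> into \<open>1 / (8 * L)\<close>.\<close>
  have quot: "eta * (x / v) \<le> tr (x / v) \<and> tr (x / v) \<le> x / v \<and> 0 \<le> tr (x / v) \<and>
      1 / (8 * real L) \<le> tr (x / v) \<and> tr (x / v) \<le> 1"
    if "1 / (2 * real L) \<le> x" "x \<le> 1" "1 \<le> v" "v \<le> 3" "1 \<le> L" "L \<le> M" for x v L
  proof -
    have x0: "0 \<le> x" using order_trans[OF _ that(1), of 0] by simp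
    have xv: "1 / (2 * real L) / 3 \<le> x / v" using that x0 by (intro frac_le) auto
    have le1: "x / v \<le> 1" using that by simp
    have "1 / (72 * real L) \<le> 1 / (2 * real L) / 3" using that by (simp add: field_simps)
    then have "1 / (72 * (real M)\<^sup>2) \<le> x / v" using inv_le[of L] inv_sq_le[of L] xv that by linarith
    then have 1: "eta * (x / v) \<le> tr (x / v)" using le1 by (intro tr_relM) linarith+
    have "3/4 * (1 / (2 * real L) / 3) \<le> eta * (x / v)" using xv e0 by (intro mult_mono) auto
    moreover have "3/4 * (1 / (2 * real L) / 3) = 1 / (8 * real L)" by simp
    moreover have "0 \<le> x / v" using x0 that by simp
    ultimately show ?thesis using 1 tr_nonneg[of "x / v"] le1 by auto
  qed
  have tN: "1 / (2 * real N) \<le> tr (1 / real N)" "tr (1 / real N) \<le> 1" "eta * (1 / real N) \<le> tr (1 / real N)" "tr (1 / real N) \<le> 1 / real N"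
    using avg_bounds[of 1 N] N1 N by auto
  note tkN = avg_bounds[OF k N1 N]
  have tj: "1 / (2 * real j) \<le> tr (1 / real j)" "tr (1 / real j) \<le> 1" "tr (1 / real j) \<le> 1 / real j"
    using avg_bounds[of 1 j] j by auto
  have tk: "1 / (2 * real k) \<le> tr (1 / real k)" "tr (1 / real k) \<le> 1" "eta * (1 / real k) \<le> tr (1 / real k)"
    using avg_bounds[of 1 k] k kM by auto
  have Q0: "eta * (tr (1 / real N) / nu_i) \<le> q0" "q0 \<le> tr (1 / real N) / nu_i" "0 \<le> q0" "1 / (8 * real N) \<le> q0" "q0 \<le> 1"
    using quot[OF tN(1,2) nui N1 N] unfolding q0_def by auto
  have Q1: "eta * (tr (real k / real N) / nu_i) \<le> q1" "q1 \<le> tr (real k / real N) / nu_i" "0 \<le> q1" "1 / (8 * real N) \<le> q1" "q1 \<le> 1"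
    using quot[OF tkN(3,4) nui N1 N] unfolding q1_def by auto
  define k0 where "k0 = tr (tr (1 / real k) / nu_k)"
  define k1 where "k1 = tr (1 / nu_k)"
  define j0 where "j0 = tr (tr (1 / real j) / nu_j)"
  define j1 where "j1 = tr (1 / nu_j)"
  have K0: "eta * (tr (1 / real k) / nu_k) \<le> k0" "0 \<le> k0" "1 / (8 * real k) \<le> k0" "k0 \<le> 1"
    using quot[OF tk(1,2) nuk(1,2) k(1) kM] unfolding k0_def by auto
  have K1: "eta * (1 / nu_k) \<le> k1" "0 \<le> k1" "1 / 8 \<le> k1" "k1 \<le> 1"
    using quot[of 1 1 nu_k] nuk M_ge unfolding k1_def by auto
  have J0: "j0 \<le> tr (1 / real j) / nu_j" "0 \<le> j0"
    using quot[OF tj(1,2) nuj(1,2) j(2,3)] unfolding j0_def by auto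
  have J1: "j1 \<le> 1 / nu_j" "0 \<le> j1"
    using quot[of 1 1 nu_j] nuj M_ge unfolding j1_def by auto
  define gj where "gj = sqrt (4 + 4 / (real j)\<^sup>2)"
  define gk where "gk = sqrt (4 + 4 / (real k)\<^sup>2)"
  have g: "0 < gj" "0 < gk" unfolding gj_def gk_def by (auto intro!: add_pos_nonneg)
  \<comment> \<open>Up to rounding, the query is \<open>w * (1, k)\<close>; the factor
    \<open>w\<close> cancels in the comparison.\<close>
  define w where "w = 1 / (real N * nu_i)"
  have w: "0 < w" unfolding w_def using N1 nui by simp
  have q0u: "q0 \<le> w"
  proof -
    have "tr (1 / real N) / nu_i \<le> 1 / real N / nu_i" using tN nui by (intro divide_right_mono) auto
    then show ?thesis using Q0 unfolding w_def by simp
  qed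
  have q1u: "q1 \<le> real k * w"
  proof -
    have "tr (real k / real N) / nu_i \<le> real k / real N / nu_i" using tkN nui by (intro divide_right_mono) auto
    then show ?thesis using Q1 unfolding w_def by simp
  qed
  have j0u: "j0 \<le> 1 / real j / (eta ^ 3 * gj)"
  proof -
    have "tr (1 / real j) / nu_j \<le> 1 / real j / (eta ^ 3 * gj)"
      using tj nuj e0 g unfolding gj_def by (intro frac_le) auto
    then show ?thesis using J0 by simp
  qed
  have j1u: "j1 \<le> 1 / (eta ^ 3 * gj)"
  proof -
    have "1 / nu_j \<le> 1 / (eta ^ 3 * gj)"
      using nuj e0 g unfolding gj_def by (intro frac_le) auto
    then show ?thesis using J1 by simp
  qed
  have "?L \<le> tr (q0 * j0) + tr (q1 * j1)"
    unfolding score_def j0_def[symmetric] j1_def[symmetric]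
    using Q0 Q1 J0 J1 by (intro tr_nonneg add_nonneg_nonneg) auto
  also have "\<dots> \<le> q0 * j0 + q1 * j1" using Q0 Q1 J0 J1 by (intro add_mono tr_nonneg) auto
  also have "\<dots> \<le> w * (1 / real j / (eta ^ 3 * gj)) + real k * w * (1 / (eta ^ 3 * gj))"
    using q0u q1u j0u j1u Q0 Q1 J0 J1 w by (intro add_mono mult_mono) auto
  also have "\<dots> = w * ((1 / real j + real k) / (eta ^ 3 * gj))"
    by (simp add: add_divide_distrib ring_distribs)
  also have "\<dots> < w * (eta ^ 6 * ((1 / real k + real k) / gk))"
    using circle_gap[OF j k(1) kM] w unfolding gj_def gk_def by (intro mult_strict_left_mono) auto
  finally have upper: "?L < w * (eta ^ 6 * ((1 / real k + real k) / gk))" .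
  have q0l: "eta ^ 2 * w \<le> q0"
  proof -
    have "eta * (1 / real N) / nu_i \<le> tr (1 / real N) / nu_i" using tN nui by (intro divide_right_mono) auto
    then have "eta * (eta * (1 / real N) / nu_i) \<le> eta * (tr (1 / real N) / nu_i)"
      using e0 by (intro mult_left_mono) auto
    then show ?thesis using Q0 unfolding w_def by (simp add: power2_eq_square)
  qed
  have q1l: "eta ^ 2 * (real k * w) \<le> q1"
  proof -
    have "eta * (real k / real N) / nu_i \<le> tr (real k / real N) / nu_i" using tkN nui by (intro divide_right_mono) auto
    then have "eta * (eta * (real k / real N) / nu_i) \<le> eta * (tr (real k / real N) / nu_i)"
      using e0 by (intro mult_left_mono) auto
    then show ?thesis using Q1 unfolding w_def by (simp add: power2_eq_square)
  qed
  have k0l: "eta ^ 2 * (1 / real k / gk) \<le> k0"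
  proof -
    have "eta * (1 / real k) / gk \<le> tr (1 / real k) / nu_k"
      using tk nuk e0 tr_nonneg(2)[of "1 / real k"] unfolding gk_def by (intro frac_le) auto
    then have "eta * (eta * (1 / real k) / gk) \<le> eta * (tr (1 / real k) / nu_k)"
      using e0 by (intro mult_left_mono) auto
    then show ?thesis using K0 by (simp add: power2_eq_square)
  qed
  have k1l: "eta ^ 2 * (1 / gk) \<le> k1"
  proof -
    have "1 / gk \<le> 1 / nu_k" using nuk unfolding gk_def by (intro frac_le) auto
    then have "eta * (1 / gk) \<le> eta * (1 / nu_k)" using e0 by (intro mult_left_mono) auto
    moreover have "eta ^ 2 * (1 / gk) \<le> eta * (1 / gk)"
      using e0 g by (intro mult_right_mono) (auto simp: power2_eq_square)
    ultimately show ?thesis using K1 by linarith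
  qed
  \<comment> \<open>The rounded products must again exceed the threshold of \<open>tr_relM\<close>,
    since their sum is rounded once more.\<close>
  have prod: "eta * (x * y) \<le> tr (x * y) \<and> tr (x * y) \<le> 1 \<and> 1 / (72 * (real M)\<^sup>2) \<le> tr (x * y) \<and> 0 \<le> tr (x * y)"
    if "1 / (8 * real M) \<le> x" "1 / (8 * real M) \<le> y" "x \<le> 1" "y \<le> 1" for x y
  proof -
    have xy0: "0 \<le> x" "0 \<le> y" using that(1,2) by (auto intro: order_trans[rotated])
    have "1 / (8 * real M) * (1 / (8 * real M)) \<le> x * y" using that xy0 by (intro mult_mono) auto
    then have l0: "1 / (64 * (real M)\<^sup>2) \<le> x * y" by (simp add: power2_eq_square)
    moreover have "1 / (72 * (real M)\<^sup>2) \<le> 1 / (64 * (real M)\<^sup>2)" using M_ge by (simp add: field_simps)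
    ultimately have l: "1 / (72 * (real M)\<^sup>2) \<le> x * y" by linarith
    have u: "x * y \<le> 1" using that xy0 by (intro mult_le_one) auto
    have 1: "eta * (x * y) \<le> tr (x * y)" using l u by (intro tr_relM) auto
    have "99/100 * (1 / (64 * (real M)\<^sup>2)) \<le> eta * (x * y)" using l0 e0 by (intro mult_mono) auto
    moreover have "1 / (72 * (real M)\<^sup>2) \<le> 99/100 * (1 / (64 * (real M)\<^sup>2))" using M_ge by (simp add: field_simps)
    ultimately show ?thesis using 1 u xy0 tr_nonneg[of "x * y"] by auto
  qed
  have lowM: "1 / (8 * real M) \<le> 1 / (8 * real L)" if "1 \<le> L" "L \<le> M" for L
    using that by (intro divide_left_mono) auto
  have "1 / (8 * real M) \<le> 1 / 8" using M_ge by (simp add: field_simps)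
  then have M8: "1 / (8 * real M) \<le> q0" "1 / (8 * real M) \<le> q1" "1 / (8 * real M) \<le> k0" "1 / (8 * real M) \<le> k1"
    using Q0 Q1 K0 K1 lowM[OF N1 N] lowM[OF k(1) kM] by linarith+
  note p0 = prod[OF M8(1,3) Q0(5) K0(4)] and p1 = prod[OF M8(2,4) Q1(5) K1(4)]
  have "eta ^ 2 * w * (eta ^ 2 * (1 / real k / gk)) \<le> q0 * k0"
    using q0l k0l w g e0 Q0 by (intro mult_mono) auto
  moreover have "eta ^ 2 * (real k * w) * (eta ^ 2 * (1 / gk)) \<le> q1 * k1"
    using q1l k1l w g e0 Q1 by (intro mult_mono) auto
  ultimately have "eta ^ 2 * w * (eta ^ 2 * (1 / real k / gk)) + eta ^ 2 * (real k * w) * (eta ^ 2 * (1 / gk))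
      \<le> q0 * k0 + q1 * k1" by linarith
  moreover have "eta ^ 2 * w * (eta ^ 2 * (1 / real k / gk)) + eta ^ 2 * (real k * w) * (eta ^ 2 * (1 / gk))
      = eta ^ 4 * (w * ((1 / real k + real k) / gk))"
    by (simp add: power_numeral_reduce add_divide_distrib ring_distribs mult_ac)
  ultimately have "eta ^ 2 * (eta ^ 4 * (w * ((1 / real k + real k) / gk))) \<le> eta ^ 2 * (q0 * k0 + q1 * k1)"
    by (intro mult_left_mono) auto
  also have "\<dots> = eta * (eta * (q0 * k0) + eta * (q1 * k1))" by (simp add: power2_eq_square algebra_simps)
  also have "\<dots> \<le> eta * (tr (q0 * k0) + tr (q1 * k1))"
    using p0 p1 e0 by (intro mult_left_mono add_mono) auto
  also have "\<dots> \<le> ?R" unfolding score_def k0_def[symmetric] k1_def[symmetric]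
    using p0 p1 by (intro tr_relM) linarith+
  finally have lower: "w * (eta ^ 6 * ((1 / real k + real k) / gk)) \<le> ?R"
    by (simp add: power_numeral_reduce mult_ac)
  show "?L < ?R" using lower upper by linarith
  have "0 < w * (eta ^ 6 * ((1 / real k + real k) / gk))" using w g e0 k by (simp add: add_pos_nonneg)
  then show "0 < ?R" using lower by linarith
qed

end

section \<open>The counting layer\<close>

text \<open>
  The first \<open>3 * V + 5\<close> coordinates hold the one-hot encoding of the token, that of the token
  fetched by the second layer (scaled), that of the computed next state (scaled), the constant 1,
  the fraction \<open>a\<close> of \<open>Bos\<close> and the fraction \<open>c\<close> of non-input tokens among the preceding tokens, the
  fraction \<open>d\<close> of input tokens minus \<open>c\<close>, and a flag \<open>e\<close> that is positive iff \<open>d\<close> is. The second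
  half of the dimensions is unused: it only receives the negations in \<open>sel_mat\<close>.
\<close>

definition residual ::
  "nat \<Rightarrow> nat \<Rightarrow> (nat \<Rightarrow> real) \<Rightarrow> (nat \<Rightarrow> real) \<Rightarrow> real \<Rightarrow> real \<Rightarrow> real \<Rightarrow> real \<Rightarrow> rvec" where
  "residual V t r z a c d e = (\<lambda>i.
     if i < V then of_bool (i = t) else if i < 2 * V then r (i - V)
     else if i < 3 * V then z (i - 2 * V) else if i = 3 * V then 1 else if i = 3 * V + 1 then a
     else if i = 3 * V + 2 then c else if i = 3 * V + 3 then d else if i = 3 * V + 4 then e else 0)"

abbreviation half_dim :: "nat \<Rightarrow> nat" where
  "half_dim V \<equiv> 3 * V + 5"

text \<open>
  On a one-hot vector extended by the constant 1, the pre-norm of \<open>sel_mat\<close> is exactly 2. The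
  normalized entries are therefore exactly \<open>1 / 2\<close>, which explains the weights 2 of the values.
\<close>

definition count_layer :: "nat \<Rightarrow> nat \<Rightarrow> nat set \<Rightarrow> layer_params" where
  "count_layer V b I =
     \<lparr>att_proj = sel_mat (half_dim V) (insert (3 * V) {..<V}),
      att_heads = (\<lambda>_. \<lparr>wq = (\<lambda>_ _. 0), bq = (\<lambda>_. 0), wk = (\<lambda>_ _. 0), bk = (\<lambda>_. 0),
        wu = (\<lambda>i j. if V \<le> j then 0 else if i = 3 * V + 1 then 2 * of_bool (j = b)
                else if i = 3 * V + 2 then 2 * of_bool (j \<notin> I)
                else if i = 3 * V + 3 then (if j \<in> I then 2 else - 2) else 0),
        bu = (\<lambda>_. 0)\<rparr>),
      wo = id_mat, bo = (\<lambda>_. 0),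
      ff_proj = sel_mat (half_dim V) {3 * V + 3},
      w1 = (\<lambda>i j. of_bool (i = 0 \<and> j = 3 * V + 3)), b1 = (\<lambda>_. 0),
      w2 = (\<lambda>i j. of_bool (i = 3 * V + 4 \<and> j = 0)), b2 = (\<lambda>_. 0)\<rparr>"

text \<open>
  The key subtracts the entry of \<open>Bos\<close> from the constant one because position 1 has no
  predecessors: its key would otherwise point in the limiting direction \<open>(0, 1)\<close>.
  The hidden unit \<open>q * V + u\<close> computes the entry of the fetched token \<open>u\<close> minus those of all own
  tokens except \<open>q\<close>. As fetched entries never exceed the own one, it is positive only if the own
  token is \<open>q\<close> and \<open>u\<close> was fetched.
\<close>

definition fetch_layer :: "nat \<Rightarrow> nat \<Rightarrow> nat set \<Rightarrow> (nat \<Rightarrow> nat \<Rightarrow> nat) \<Rightarrow> layer_params" where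
  "fetch_layer V b Q nxt =
     \<lparr>att_proj = sel_mat (half_dim V) ({..<V} \<union> {3 * V, 3 * V + 1, 3 * V + 2}),
      att_heads = (\<lambda>_. \<lparr>
        wq = (\<lambda>i j. of_bool (i = 0 \<and> j = 3 * V + 1 \<or> i = 1 \<and> j = 3 * V + 2)), bq = (\<lambda>_. 0),
        wk = (\<lambda>i j. of_bool (i = 0 \<and> j = 3 * V + 1 \<or> i = 1 \<and> j = 3 * V) - of_bool (i = 1 \<and> j = b)),
        bk = (\<lambda>_. 0),
        wu = (\<lambda>i j. of_bool (j < V \<and> i = V + j)), bu = (\<lambda>_. 0)\<rparr>),
      wo = id_mat, bo = (\<lambda>_. 0),
      ff_proj = sel_mat (half_dim V) ({..<2 * V} \<union> {3 * V + 4}),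
      w1 = (\<lambda>i j. of_bool (j = V + i mod V) - of_bool (j < V \<and> j \<noteq> i div V)), b1 = (\<lambda>_. 0),
      w2 = (\<lambda>i j. of_bool (2 * V \<le> i \<and> i < 3 * V \<and> j div V \<in> Q \<and> i - 2 * V = nxt (j div V) (j mod V))),
      b2 = (\<lambda>_. 0)\<rparr>"

context float_format
begin

lemma attn_head_floats [simp]: "attn_head p m dh P X i c \<in> floats p"
  by (simp add: attn_head_def Let_def)

lemma attn_sublayer_single_head:
  fixes T :: "'a transformer"
  assumes "n_heads T = 1" "wo P = id_mat" "bo P = (\<lambda>_. 0)"
  shows "attn_sublayer p T P R i c =
    tr ((if c < dim T then attn_head p (dim T) (dim T) (att_heads P 0)
                             (\<lambda>j. proj_norm p (dim T) (att_proj P) (R j)) i c else 0) + R i c)"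
proof -
  define a where "a = (\<lambda>c. attn_head p (dim T) (dim T) (att_heads P (c div dim T))
                             (\<lambda>j. proj_norm p (dim T) (att_proj P) (R j)) i (c mod dim T))"
  have "attn_sublayer p T P R i c = vadd p (affine p (dim T) id_mat (\<lambda>_. 0) a) (R i) c"
    unfolding attn_sublayer_def Let_def head_dim_def assms a_def by simp
  also have "\<dots> = tr (matvec p (dim T) id_mat a c + R i c)"
    unfolding vadd_def affine_zero_bias matvec_def ..
  also have "matvec p (dim T) id_mat a c = (if c < dim T then a c else 0)"
    by (rule matvec_id) (simp add: a_def)
  finally show ?thesis by (simp add: a_def)
qed

lemma ff_sublayer_zero_bias:
  fixes T :: "'a transformer"
  assumes "b1 P = (\<lambda>_. 0)" "b2 P = (\<lambda>_. 0)"
  shows "ff_sublayer p T P v c =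
    tr (dot p (ff_width T) (w2 P c)
          (\<lambda>c. max 0 (dot p (dim T) (w1 P c) (proj_norm p (dim T) (ff_proj P) v))) + v c)"
  unfolding ff_sublayer_def Let_def assms vadd_def[of p "affine _ _ _ _ _"] affine_zero_bias ..

lemma max_floats [simp]: "x \<in> floats p \<Longrightarrow> y \<in> floats p \<Longrightarrow> max x y \<in> floats p"
  by (simp add: max_def)

lemma residual_floats:
  assumes "\<And>i. i < V \<Longrightarrow> r i \<in> floats p" "\<And>i. i < V \<Longrightarrow> z i \<in> floats p"
    "a \<in> floats p" "c \<in> floats p" "d \<in> floats p" "e \<in> floats p"
  shows "residual V t r z a c d e i \<in> floats p"
  using assms by (auto simp: residual_def)

text \<open>At position 1 the sum is empty and division by 0 yields 0, which agrees with the default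
  output of \<open>attn_head\<close>.\<close>

definition avg :: "(nat \<Rightarrow> real) \<Rightarrow> nat \<Rightarrow> real" where
  "avg f i = tr (tr (\<Sum>j\<in>{1..<i}. f j) / real (i - 1))"

text \<open>The ReLU of the pre-norm of the single coordinate \<open>d\<close>. For
  \<open>d > 0\<close> it is about \<open>1 / sqrt 2\<close>, however small \<open>d\<close> may
  be.\<close>

definition flag :: "real \<Rightarrow> real" where
  "flag d = (if d \<noteq> 0 then max 0 (tr (d / tr (sqrt (tr (2 * tr (d * d)))))) else 0)"

lemma avg_floats [simp]: "avg f i \<in> floats p" and flag_floats [simp]: "flag d \<in> floats p"
  by (simp_all add: avg_def flag_def)

lemma proj_norm_count:
  assumes t: "t < V" and i: "i < half_dim V"
  shows "proj_norm p (2 * half_dim V) (sel_mat (half_dim V) (insert (3 * V) {..<V}))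
           (residual V t r z a c d e) i = (if i = t \<or> i = 3 * V then 1/2 else 0)"
proof -
  let ?K = "insert (3 * V) {..<V}" and ?v = "residual V t r z a c d e"
  have v: "?v i = of_bool (i = t \<or> i = 3 * V)" if "i \<in> ?K" for i
    using that t by (auto simp: residual_def)
  have "(\<Sum>i\<in>?K. tr (?v i * ?v i)) = (\<Sum>i\<in>?K. of_bool (i = t \<or> i = 3 * V))"
    by (intro sum.cong) (auto simp: v)
  also have "\<dots> = (\<Sum>i\<in>{t, 3 * V}. 1)"
    using t by (intro sum.mono_neutral_cong_right) auto
  also have "\<dots> = 2" using t by simp
  finally have "sel_norm ?K ?v = 2" unfolding sel_norm_def by simp
  moreover have "\<exists>j\<in>?K. ?v j \<noteq> 0" by (intro bexI[of _ "3 * V"]) (auto simp: v)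
  moreover have "?v j \<in> floats p" if "j \<in> ?K" for j using v[OF that] by simp
  moreover have "?K \<subseteq> {..<half_dim V}" by auto
  ultimately show ?thesis using i t by (subst proj_norm_sel) (auto simp: v)
qed

lemma count_attn:
  fixes T :: "'a transformer"
  assumes T: "n_heads T = 1" "dim T = 2 * half_dim V" and tk: "\<And>j. tk j < V"
  defines "R \<equiv> \<lambda>j. residual V (tk j) (\<lambda>_. 0) (\<lambda>_. 0) 0 0 0 0"
  shows "attn_sublayer p T (count_layer V b I) R i =
    residual V (tk i) (\<lambda>_. 0) (\<lambda>_. 0) (avg (\<lambda>j. of_bool (tk j = b)) i)
      (avg (\<lambda>j. of_bool (tk j \<notin> I)) i) (avg (\<lambda>j. if tk j \<in> I then 1 else - 1) i) 0"
    (is "_ = ?r")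
proof
  fix c
  define P where "P = att_heads (count_layer V b I) 0"
  define X where "X = (\<lambda>j. proj_norm p (dim T) (att_proj (count_layer V b I)) (R j))"
  have X: "X j i = (if i = tk j \<or> i = 3 * V then 1/2 else 0)" if "i < half_dim V" for j i
    using proj_norm_count[OF tk that] unfolding X_def R_def T by (simp add: count_layer_def)
  have zero: "affine p (dim T) (\<lambda>_ _. 0) (\<lambda>_. 0) x = (\<lambda>_. 0)" for x
    unfolding affine_zero_bias fun_eq_iff by (simp add: dot_zero)
  \<comment> \<open>Zero queries and keys give all predecessors the score 0, so saturated attention
    becomes a uniform average.\<close>
  have S: "{j. is_arg_max (\<lambda>j. dot p (dim T) (affine p (dim T) (wq P) (bq P) (X i))
      (affine p (dim T) (wk P) (bk P) (X j))) (\<lambda>j. j \<in> {1..<i}) j} = {1..<i}"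
    unfolding P_def count_layer_def by (auto simp: zero is_arg_max_def dot_zero)
  \<comment> \<open>\<open>wu\<close> vanishes on the columns from \<open>V\<close> on, which
    removes the constant coordinate and the negated half; of the remaining entries only that of the
    own token is nonzero.\<close>
  have U: "affine p (dim T) (wu P) (bu P) (X j) c = tr (wu P c (tk j) / 2)" for j
  proof -
    have "dot p (dim T) (wu P c) (X j) = tr (wu P c (tk j) * X j (tk j))"
    proof (rule dot_single)
      fix i assume "i < dim T" "i \<noteq> tk j"
      then show "wu P c i * X j i = 0" using X[of i j] tk[of j]
        by (cases "i < V") (auto simp: P_def count_layer_def)
    qed (use tk[of j] T in auto)
    moreover have "bu P = (\<lambda>_. 0)" by (simp add: P_def count_layer_def)
    ultimately show ?thesis using X[of "tk j" j] tk[of j] by (simp add: affine_zero_bias)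
  qed
  have head: "attn_head p (dim T) (dim T) P X i c = avg (\<lambda>j. tr (wu P c (tk j) / 2)) i"
    unfolding attn_head_def Let_def S by (auto simp: avg_def U)
  have "attn_sublayer p T (count_layer V b I) R i c =
      tr ((if c < dim T then avg (\<lambda>j. tr (wu P c (tk j) / 2)) i else 0) + R i c)"
    using attn_sublayer_single_head[OF T(1), of "count_layer V b I" R i c] head
    unfolding X_def P_def by (simp add: count_layer_def)
  also have "\<dots> = ?r c"
  proof -
    have V: "wu P c (tk j) = (if c = 3 * V + 1 then 2 * of_bool (tk j = b)
        else if c = 3 * V + 2 then 2 * of_bool (tk j \<notin> I)
        else if c = 3 * V + 3 then (if tk j \<in> I then 2 else - 2) else 0)" for j
      using tk[of j] by (simp add: P_def count_layer_def)
    have f0: "avg (\<lambda>j. 0) i = 0" by (simp add: avg_def)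
    consider "c = 3 * V + 1" | "c = 3 * V + 2" | "c = 3 * V + 3" |
      "c \<noteq> 3 * V + 1" "c \<noteq> 3 * V + 2" "c \<noteq> 3 * V + 3" by blast
    then show ?thesis
    proof cases
      case 1
      then have "(\<lambda>j. tr (wu P c (tk j) / 2)) = (\<lambda>j. of_bool (tk j = b))" unfolding V by auto
      with 1 show ?thesis by (simp add: R_def residual_def T)
    next
      case 2
      then have "(\<lambda>j. tr (wu P c (tk j) / 2)) = (\<lambda>j. of_bool (tk j \<notin> I))" unfolding V by auto
      with 2 show ?thesis by (simp add: R_def residual_def T)
    next
      case 3
      then have "(\<lambda>j. tr (wu P c (tk j) / 2)) = (\<lambda>j. if tk j \<in> I then 1 else - 1)"
        unfolding V by (auto simp: tr_minus)
      with 3 show ?thesis by (simp add: R_def residual_def T)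
    next
      case 4
      then have "(\<lambda>j. tr (wu P c (tk j) / 2)) = (\<lambda>j. 0)" unfolding V by simp
      then have "avg (\<lambda>j. tr (wu P c (tk j) / 2)) i = 0" using f0 by simp
      with 4 show ?thesis by (simp only: R_def residual_def) simp
    qed
  qed
  finally show "attn_sublayer p T (count_layer V b I) R i c = ?r c" .
qed

lemma count_ff:
  fixes T :: "'a transformer" and t :: nat
  assumes T: "dim T = 2 * half_dim V" "ff_width T = V * V" "0 < V"
    and fl: "a \<in> floats p" "c \<in> floats p" "d \<in> floats p"
  defines "v \<equiv> residual V t (\<lambda>_. 0) (\<lambda>_. 0) a c d 0"
  shows "ff_sublayer p T (count_layer V b I) v = residual V t (\<lambda>_. 0) (\<lambda>_. 0) a c d (flag d)"
proof
  fix k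
  let ?P = "count_layer V b I"
  define X where "X = proj_norm p (dim T) (ff_proj ?P) v"
  have vD: "v (3 * V + 3) = d" by (simp add: v_def residual_def)
  have XD: "max 0 (X (3 * V + 3)) = flag d"
    unfolding X_def T using proj_norm_sel[of "{3 * V + 3}" "half_dim V" v "3 * V + 3"] fl(3) vD
    by (simp add: count_layer_def flag_def sel_norm_def)
  have Xfl: "X (3 * V + 3) \<in> floats p"
    unfolding X_def T using proj_norm_sel[of "{3 * V + 3}" "half_dim V" v "3 * V + 3"] fl(3) vD
    by (simp add: count_layer_def)
  have z: "max 0 (dot p (dim T) (w1 ?P i) X) = (if i = 0 then flag d else 0)" for i
  proof (cases "i = 0")
    case True
    then have "dot p (dim T) (w1 ?P i) X = tr (w1 ?P i (3 * V + 3) * X (3 * V + 3))"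
      by (intro dot_single) (auto simp: T count_layer_def)
    then show ?thesis using True Xfl XD by (simp add: count_layer_def)
  next
    case False
    then show ?thesis by (subst dot_zero) (auto simp: count_layer_def)
  qed
  have "ff_sublayer p T ?P v k = tr (dot p (V * V) (w2 ?P k) (\<lambda>i. if i = 0 then flag d else 0) + v k)"
    unfolding z[symmetric] X_def T(2)[symmetric] by (rule ff_sublayer_zero_bias) (simp_all add: count_layer_def)
  also have "dot p (V * V) (w2 ?P k) (\<lambda>i. if i = 0 then flag d else 0) =
      tr (w2 ?P k 0 * (if 0 = (0::nat) then flag d else 0))"
    using T by (intro dot_single) auto
  also have "\<dots> = (if k = 3 * V + 4 then flag d else 0)" by (simp add: count_layer_def)
  finally show "ff_sublayer p T ?P v k = residual V t (\<lambda>_. 0) (\<lambda>_. 0) a c d (flag d) k"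
    using fl by (auto simp: v_def residual_def)
qed

end

section \<open>The fetching layer\<close>

context attention_precision
begin

lemma nu_floats [simp]: "nu a c \<in> floats p"
  by (simp add: nu_def)

lemma sel_norm_fetch:
  assumes "t < V"
  shows "sel_norm ({..<V} \<union> {3 * V, 3 * V + 1, 3 * V + 2}) (residual V t r z a c d e) = nu a c"
proof -
  let ?v = "residual V t r z a c d e"
  have "(\<Sum>i<V. tr (?v i * ?v i)) = tr (?v t * ?v t)"
    using assms by (intro sum_single) (auto simp: residual_def)
  then have "(\<Sum>i<V. tr (?v i * ?v i)) = 1" using assms by (simp add: residual_def)
  then have "(\<Sum>i\<in>{..<V} \<union> {3 * V, 3 * V + 1, 3 * V + 2}. tr (?v i * ?v i)) =
      1 + (\<Sum>i\<in>{3 * V, 3 * V + 1, 3 * V + 2}. tr (?v i * ?v i))"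
    by (subst sum.union_disjoint) auto
  also have "(\<Sum>i\<in>{3 * V, 3 * V + 1, 3 * V + 2}. tr (?v i * ?v i)) = 1 + tr (a * a) + tr (c * c)"
    by (simp add: residual_def)
  finally have "(\<Sum>i\<in>{..<V} \<union> {3 * V, 3 * V + 1, 3 * V + 2}. tr (?v i * ?v i)) =
      2 + tr (a * a) + tr (c * c)" by simp
  then show ?thesis unfolding sel_norm_def nu_def by (rule arg_cong[of _ _ "\<lambda>x. tr (sqrt (tr (2 * x)))"])
qed

text \<open>\<open>nu\<close> does not depend on the vocabulary, so realizing it as the norm of a
  residual with \<open>V = 1\<close> is enough; the constant coordinate supplies the entry
  1.\<close>

lemma nu_ge_1: "1 \<le> nu a c"
  using sel_norm_ge_1[of "{..<1} \<union> {3 * 1, 3 * 1 + 1, 3 * 1 + 2}" "3 * 1" "residual 1 0 undefined undefined a c 0 0"]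
    sel_norm_fetch[of 0 1 undefined undefined a c 0 0] by (simp add: residual_def)

lemma proj_norm_fetch:
  assumes t: "t < V" and fl: "a \<in> floats p" "c \<in> floats p" and i: "i < half_dim V"
  shows "proj_norm p (2 * half_dim V) (sel_mat (half_dim V) ({..<V} \<union> {3 * V, 3 * V + 1, 3 * V + 2}))
           (residual V t r z a c d e) i =
         (if i = t \<or> i = 3 * V then tr (1 / nu a c) else if i = 3 * V + 1 then tr (a / nu a c)
          else if i = 3 * V + 2 then tr (c / nu a c) else 0)"
proof -
  let ?K = "{..<V} \<union> {3 * V, 3 * V + 1, 3 * V + 2}" and ?v = "residual V t r z a c d e"
  have v: "?v i = (if i = t \<or> i = 3 * V then 1 else if i = 3 * V + 1 then a
          else if i = 3 * V + 2 then c else 0)" if "i \<in> ?K" for i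
    using that t by (auto simp: residual_def)
  have "\<exists>j\<in>?K. ?v j \<noteq> 0" by (intro bexI[of _ "3 * V"]) (auto simp: v)
  moreover have "?v j \<in> floats p" if "j \<in> ?K" for j using v[OF that] fl by simp
  moreover have "?K \<subseteq> {..<half_dim V}" by auto
  ultimately have "proj_norm p (2 * half_dim V) (sel_mat (half_dim V) ?K) ?v i =
      (if i \<in> ?K then tr (?v i / nu a c) else 0)"
    using i sel_norm_fetch[OF t] by (subst proj_norm_sel) auto
  then show ?thesis using t v[of i] by auto
qed

definition fetch_score :: "(nat \<Rightarrow> bool) \<Rightarrow> (nat \<Rightarrow> real) \<Rightarrow> (nat \<Rightarrow> real) \<Rightarrow> nat \<Rightarrow> nat \<Rightarrow> real" where
  "fetch_score bos a c i j =
     score (tr (a i / nu (a i) (c i))) (tr (c i / nu (a i) (c i))) (tr (a j / nu (a j) (c j)))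
       (if bos j then 0 else tr (1 / nu (a j) (c j)))"

definition fetch_set :: "(nat \<Rightarrow> bool) \<Rightarrow> (nat \<Rightarrow> real) \<Rightarrow> (nat \<Rightarrow> real) \<Rightarrow> nat \<Rightarrow> nat set" where
  "fetch_set bos a c i = {j. is_arg_max (fetch_score bos a c i) (\<lambda>j. j \<in> {1..<i}) j}"

definition fetched :: "nat \<Rightarrow> (nat \<Rightarrow> nat) \<Rightarrow> (nat \<Rightarrow> real) \<Rightarrow> (nat \<Rightarrow> real) \<Rightarrow> nat \<Rightarrow> nat \<Rightarrow> real" where
  "fetched b tk a c i u =
     (if i \<le> 1 then 0 else let S = fetch_set (\<lambda>j. tk j = b) a c i in
        tr (tr (\<Sum>j\<in>S. if tk j = u then tr (1 / nu (a j) (c j)) else 0) / real (card S)))"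

lemma fetched_floats [simp]: "fetched b tk a c i u \<in> floats p"
  by (simp add: fetched_def Let_def)

text \<open>An average of numbers in \<open>[0, 1]\<close>, whatever the attended set is. At the
  first decoding step nothing more is known about that set.\<close>

lemma fetched_bounds: "0 \<le> fetched b tk a c i u" "fetched b tk a c i u \<le> 1"
proof -
  define S where "S = fetch_set (\<lambda>j. tk j = b) a c i"
  define f where "f = (\<lambda>j. if tk j = u then tr (1 / nu (a j) (c j)) else 0)"
  have f: "0 \<le> f j" "f j \<le> 1" for j
    using nu_ge_1[of "a j" "c j"] by (auto simp: f_def intro!: tr_nonneg tr_le)
  have s0: "0 \<le> sum f S" using f by (intro sum_nonneg) auto
  have s1: "sum f S \<le> real (card S)" using sum_bounded_above[of S f 1] f by simp
  have 0: "0 \<le> tr (sum f S) / real (card S)" using s0 by (intro divide_nonneg_nonneg tr_nonneg) auto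
  have "tr (sum f S) / real (card S) \<le> 1"
    using s1 tr_nonneg(3)[OF s0] by (cases "card S = 0") (auto simp: divide_le_eq_1)
  then show "0 \<le> fetched b tk a c i u" "fetched b tk a c i u \<le> 1"
    using tr_nonneg(2)[OF 0] tr_le[OF floats_simps(2)]
    unfolding fetched_def Let_def S_def[symmetric] f_def[symmetric] by auto
qed

lemma fetch_attn:
  fixes T :: "'a transformer"
  assumes T: "n_heads T = 1" "dim T = 2 * half_dim V" and tk: "\<And>j. tk j < V" and b: "b < V"
    and fl: "\<And>j. a j \<in> floats p" "\<And>j. c j \<in> floats p" "\<And>j. d j \<in> floats p" "\<And>j. e j \<in> floats p"
  defines "R \<equiv> \<lambda>j. residual V (tk j) (\<lambda>_. 0) (\<lambda>_. 0) (a j) (c j) (d j) (e j)"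
  shows "attn_sublayer p T (fetch_layer V b Q nxt) R i =
    residual V (tk i) (fetched b tk a c i) (\<lambda>_. 0) (a i) (c i) (d i) (e i)"
    (is "_ = ?r")
proof
  fix k
  let ?L = "fetch_layer V b Q nxt"
  define P where "P = att_heads ?L 0"
  define X where "X = (\<lambda>j. proj_norm p (dim T) (att_proj ?L) (R j))"
  define n where "n = (\<lambda>j. nu (a j) (c j))"
  have X: "X j i = (if i = tk j \<or> i = 3 * V then tr (1 / n j) else if i = 3 * V + 1 then tr (a j / n j)
          else if i = 3 * V + 2 then tr (c j / n j) else 0)" if "i < half_dim V" for j i
    using proj_norm_fetch[OF tk fl(1,2) that] unfolding X_def R_def T n_def by (simp add: fetch_layer_def)
  have bias: "bq P = (\<lambda>_. 0)" "bk P = (\<lambda>_. 0)" "bu P = (\<lambda>_. 0)" by (simp_all add: P_def fetch_layer_def)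
  define q where "q = (\<lambda>j. affine p (dim T) (wq P) (bq P) (X j))"
  define h where "h = (\<lambda>j. affine p (dim T) (wk P) (bk P) (X j))"
  have q0: "q j 0 = tr (a j / n j)" for j
  proof -
    have "dot p (dim T) (wq P 0) (X j) = tr (wq P 0 (3 * V + 1) * X j (3 * V + 1))"
      by (intro dot_single) (auto simp: T P_def fetch_layer_def)
    then show ?thesis using X[of "3 * V + 1" j] tk[of j]
      by (simp add: q_def bias affine_zero_bias) (simp add: P_def fetch_layer_def)
  qed
  have q1: "q j 1 = tr (c j / n j)" for j
  proof -
    have "dot p (dim T) (wq P 1) (X j) = tr (wq P 1 (3 * V + 2) * X j (3 * V + 2))"
      by (intro dot_single) (auto simp: T P_def fetch_layer_def)
    then show ?thesis using X[of "3 * V + 2" j] tk[of j]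
      by (simp add: q_def bias affine_zero_bias) (simp add: P_def fetch_layer_def)
  qed
  have q2: "q j i = 0" if "i \<noteq> 0" "i \<noteq> 1" for i j
    using that by (simp add: q_def bias affine_zero_bias) (auto simp: P_def fetch_layer_def intro!: dot_zero)
  have h0: "h j 0 = tr (a j / n j)" for j
  proof -
    have "dot p (dim T) (wk P 0) (X j) = tr (wk P 0 (3 * V + 1) * X j (3 * V + 1))"
      by (intro dot_single) (auto simp: T P_def fetch_layer_def)
    then show ?thesis using X[of "3 * V + 1" j] tk[of j]
      by (simp add: h_def bias affine_zero_bias) (simp add: P_def fetch_layer_def)
  qed
  \<comment> \<open>The own token and the constant are normalized to the same float, so at
    \<open>Bos\<close> they cancel without a rounding residue.\<close>
  have h1: "h j 1 = (if tk j = b then 0 else tr (1 / n j))" for j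
  proof -
    have "dot p (dim T) (wk P 1) (X j) =
        tr (tr (wk P 1 (3 * V) * X j (3 * V)) + tr (wk P 1 b * X j b))"
      using b by (intro dot_two) (auto simp: T P_def fetch_layer_def)
    then have "h j 1 = tr (tr (wk P 1 (3 * V) * X j (3 * V)) + tr (wk P 1 b * X j b))"
      by (simp add: h_def bias affine_zero_bias)
    moreover have "wk P 1 (3 * V) = 1" "wk P 1 b = - 1" using b by (auto simp: P_def fetch_layer_def)
    moreover have "X j (3 * V) = tr (1 / n j)" "X j b = (if tk j = b then tr (1 / n j) else 0)"
      using X[of "3 * V" j] X[of b j] b by auto
    ultimately show ?thesis by (simp add: tr_minus)
  qed
  have sc: "dot p (dim T) (q i) (h j) = fetch_score (\<lambda>j. tk j = b) a c i j" for j
  proof -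
    have "dot p (dim T) (q i) (h j) = tr (tr (q i 0 * h j 0) + tr (q i 1 * h j 1))"
      by (intro dot_two) (auto simp: T q2)
    then show ?thesis by (simp add: q0 q1[simplified] h0 h1[simplified] fetch_score_def score_def n_def)
  qed
  have U: "affine p (dim T) (wu P) (bu P) (X j) k =
      (if V \<le> k \<and> k < 2 * V \<and> tk j = k - V then tr (1 / n j) else 0)" for j
  proof (cases "V \<le> k \<and> k < 2 * V")
    case True
    then have "dot p (dim T) (wu P k) (X j) = tr (wu P k (k - V) * X j (k - V))"
      by (intro dot_single) (auto simp: T P_def fetch_layer_def)
    moreover have "wu P k (k - V) = 1" using True by (auto simp: P_def fetch_layer_def)
    ultimately show ?thesis using X[of "k - V" j] True by (auto simp: bias affine_zero_bias)
  next
    case False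
    then show ?thesis by (auto simp: bias affine_zero_bias) (auto simp: P_def fetch_layer_def intro!: dot_zero)
  qed
  have S: "{j. is_arg_max (\<lambda>j. dot p (dim T) (affine p (dim T) (wq P) (bq P) (X i))
      (affine p (dim T) (wk P) (bk P) (X j))) (\<lambda>j. j \<in> {1..<i}) j} = fetch_set (\<lambda>j. tk j = b) a c i"
    unfolding fetch_set_def sc[symmetric] q_def h_def ..
  have head: "attn_head p (dim T) (dim T) P X i k =
      (if V \<le> k \<and> k < 2 * V then fetched b tk a c i (k - V) else 0)"
    unfolding attn_head_def Let_def S fetched_def by (auto simp: U[unfolded n_def])
  have "attn_sublayer p T ?L R i k = tr ((if k < dim T then attn_head p (dim T) (dim T) P X i k else 0) + R i k)"
    unfolding X_def P_def by (rule attn_sublayer_single_head) (simp_all add: T fetch_layer_def)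
  also have "\<dots> = ?r k" unfolding head using fl
    by (auto simp: T R_def residual_def)
  finally show "attn_sublayer p T ?L R i k = ?r k" .
qed

text \<open>If the own token is not \<open>i div V\<close>, the unit receives
  \<open>tr (r u / n) - tr (1 / n)\<close> with \<open>u = i mod V\<close>. This is nonpositive
  because truncation is monotone and \<open>r u \<le> 1\<close>, so ReLU gives exactly 0.\<close>

lemma fetch_hidden_units:
  fixes T :: "'a transformer" and a c d :: real
  assumes T: "dim T = 2 * half_dim V" and t: "t < V" and i: "i < V * V"
    and r: "\<And>u. r u \<in> floats p" "\<And>u. 0 \<le> r u" "\<And>u. r u \<le> 1" and e: "e \<in> floats p"
  defines "v \<equiv> residual V t r (\<lambda>_. 0) a c d e"
  defines "n \<equiv> sel_norm ({..<2 * V} \<union> {3 * V + 4}) v"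
  shows "max 0 (dot p (dim T) (w1 (fetch_layer V b Q nxt) i) (proj_norm p (dim T) (ff_proj (fetch_layer V b Q nxt)) v))
    = (if i div V = t then tr (r (i mod V) / n) else 0)"
proof -
  let ?K = "{..<2 * V} \<union> {3 * V + 4}" and ?W = "w1 (fetch_layer V b Q nxt) i"
  define X where "X = proj_norm p (dim T) (ff_proj (fetch_layer V b Q nxt)) v"
  have vt: "v t = 1" using t by (simp add: v_def residual_def)
  have n: "1 \<le> n" unfolding n_def using t vt by (intro sel_norm_ge_1[of _ t]) auto
  have X: "X j = (if j \<in> ?K then tr (v j / n) else 0)" if "j < half_dim V" for j
  proof -
    have "v j \<in> floats p" if "j \<in> ?K" for j
      using that r e by (auto simp: v_def residual_def)
    moreover have "\<exists>j\<in>?K. v j \<noteq> 0" using vt t by (intro bexI[of _ t]) auto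
    moreover have "?K \<subseteq> {..<half_dim V}" by auto
    ultimately show ?thesis using that proj_norm_sel[of ?K "half_dim V" v j]
      unfolding X_def n_def T by (simp add: fetch_layer_def)
  qed
  have u: "i mod V < V" using t by simp
  have Xr: "X (V + i mod V) = tr (r (i mod V) / n)"
    using X[of "V + i mod V"] u by (simp add: v_def residual_def)
  have Xt: "X t = tr (1 / n)" using X[of t] t vt by simp
  have X0: "X j = 0" if "j < V" "j \<noteq> t" for j
    using X[of j] that by (simp add: v_def residual_def)
  have "dot p (dim T) ?W X = tr (tr (?W (V + i mod V) * X (V + i mod V)) + tr (?W t * X t))"
  proof (rule dot_two)
    show "V + i mod V < dim T" using u unfolding T distrib_left by linarith
  qed (use t X0 in \<open>auto simp: T fetch_layer_def\<close>)
  also have "?W (V + i mod V) = 1" by (simp add: fetch_layer_def)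
  also have "?W t = - of_bool (i div V \<noteq> t)" using t by (auto simp: fetch_layer_def)
  finally have "dot p (dim T) ?W X = tr (tr (r (i mod V) / n) - of_bool (i div V \<noteq> t) * tr (1 / n))"
    by (cases "i div V = t") (auto simp: Xr Xt tr_minus)
  moreover have "0 \<le> tr (r (i mod V) / n)" using r n by (intro tr_nonneg) auto
  moreover have "tr (r (i mod V) / n) \<le> tr (1 / n)" using r n by (intro tr_mono divide_right_mono) auto
  then have "tr (tr (r (i mod V) / n) - tr (1 / n)) \<le> 0" by (intro tr_le) auto
  ultimately show ?thesis unfolding X_def[symmetric] by auto
qed

text \<open>The feedforward block is a lookup table over pairs of own and fetched token. Only units
  in row \<open>t\<close> can be active: \<open>w2\<close> ignores the row of a non-state, and for a
  state with one fetched token \<open>u\<close> the single active unit is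
  \<open>t * V + u\<close>.\<close>

lemma fetch_ff:
  fixes T :: "'a transformer"
  assumes T: "dim T = 2 * half_dim V" "ff_width T = V * V" and t: "t < V"
    and r: "\<And>u. r u \<in> floats p" "\<And>u. 0 \<le> r u" "\<And>u. r u \<le> 1"
    and fl: "a \<in> floats p" "c \<in> floats p" "d \<in> floats p" "e \<in> floats p"
  defines "v \<equiv> residual V t r (\<lambda>_. 0) a c d e"
  defines "n \<equiv> sel_norm ({..<2 * V} \<union> {3 * V + 4}) v"
  shows "t \<notin> Q \<Longrightarrow> ff_sublayer p T (fetch_layer V b Q nxt) v = v"
    and "t \<in> Q \<Longrightarrow> u < V \<Longrightarrow> (\<And>u'. u' \<noteq> u \<Longrightarrow> r u' = 0) \<Longrightarrow>
      ff_sublayer p T (fetch_layer V b Q nxt) v =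
        residual V t r (\<lambda>i. if i = nxt t u then tr (r u / n) else 0) a c d e"
proof -
  let ?L = "fetch_layer V b Q nxt"
  define Z where "Z = (\<lambda>i. max 0 (dot p (dim T) (w1 ?L i) (proj_norm p (dim T) (ff_proj ?L) v)))"
  have Z: "Z i = (if i div V = t then tr (r (i mod V) / n) else 0)" if "i < V * V" for i
    unfolding Z_def n_def v_def using fetch_hidden_units[OF T(1) t that r fl(4)] by simp
  have F: "ff_sublayer p T ?L v k = tr (dot p (V * V) (w2 ?L k) Z + v k)" for k
    unfolding Z_def T(2)[symmetric] by (rule ff_sublayer_zero_bias) (simp_all add: fetch_layer_def)
  have vfl: "v k \<in> floats p" for k
    unfolding v_def using r fl by (intro residual_floats) auto
  show "ff_sublayer p T ?L v = v" if "t \<notin> Q"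
  proof
    fix k
    have "dot p (V * V) (w2 ?L k) Z = 0"
      using that Z by (intro dot_zero) (auto simp: fetch_layer_def)
    then show "ff_sublayer p T ?L v k = v k" using vfl F by simp
  qed
  show "ff_sublayer p T ?L v = residual V t r (\<lambda>i. if i = nxt t u then tr (r u / n) else 0) a c d e"
    if tQ: "t \<in> Q" and u: "u < V" and ru: "\<And>u'. u' \<noteq> u \<Longrightarrow> r u' = 0"
  proof
    fix k
    define i0 where "i0 = t * V + u"
    have i0: "i0 div V = t" "i0 mod V = u" using u by (auto simp: i0_def)
    have "Suc t * V \<le> V * V" using t by (intro mult_le_mono1) simp
    then have i0V: "i0 < V * V" using u by (simp add: i0_def)
    have Z0: "Z i = 0" if "i < V * V" "i \<noteq> i0" for i
    proof (cases "i div V = t")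
      case True
      then have "i mod V \<noteq> u" using that(2) unfolding i0_def by (metis div_mult_mod_eq)
      then show ?thesis using Z[OF that(1)] ru by simp
    qed (use Z[OF that(1)] in simp)
    have "dot p (V * V) (w2 ?L k) Z = tr (w2 ?L k i0 * Z i0)"
      using i0V Z0 by (intro dot_single) auto
    also have "\<dots> = (if 2 * V \<le> k \<and> k < 3 * V \<and> k - 2 * V = nxt t u then tr (r u / n) else 0)"
      using Z[OF i0V] i0 tQ by (auto simp: fetch_layer_def)
    finally show "ff_sublayer p T ?L v k =
        residual V t r (\<lambda>i. if i = nxt t u then tr (r u / n) else 0) a c d e k"
      unfolding F using vfl[of k] by (auto simp: v_def residual_def)
  qed
qed

end

section \<open>The transformer of an automaton\<close>

lemma arg_max_eq:
  fixes f :: "'b \<Rightarrow> real"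
  assumes "P x" "\<And>y. P y \<Longrightarrow> y \<noteq> x \<Longrightarrow> f y < f x"
  shows "arg_max f P = x"
  unfolding arg_max_def is_arg_max_def
proof (rule some_equality)
  show "P x \<and> (\<nexists>y. P y \<and> f x < f y)" using assms by force
qed (use assms in blast)

lemma is_arg_max_iff:
  fixes f :: "'b \<Rightarrow> real"
  assumes "P x" "\<And>y. P y \<Longrightarrow> y \<noteq> x \<Longrightarrow> f y < f x"
  shows "is_arg_max f P y \<longleftrightarrow> y = x"
  using assms unfolding is_arg_max_def by force

text \<open>The state \<open>q\<close> is represented by \<open>Extra q\<close>. The bound on
  \<open>ix\<close> holds for tokens outside the vocabulary too, so the layer computations apply at
  all positions without range conditions.\<close>

locale dfa =
  fixes A :: "'a set" and Q :: "nat set" and \<delta> :: "nat \<Rightarrow> 'a \<Rightarrow> nat" and q0 :: nat and F :: "nat set"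
    and r V :: nat and ix :: "'a token \<Rightarrow> nat"
  assumes Q_less: "Q \<subseteq> {..<r}" and q0: "q0 \<in> Q" and F: "F \<subseteq> Q"
    and \<delta>: "\<And>q a. q \<in> Q \<Longrightarrow> a \<in> A \<Longrightarrow> \<delta> q a \<in> Q"
    and ix_less: "\<And>\<sigma>. ix \<sigma> < V" and ix_inj: "inj_on ix (vocab A r)"
begin

definition token_at :: "nat \<Rightarrow> 'a token" where
  "token_at = inv_into (vocab A r) ix"

definition nxt :: "nat \<Rightarrow> nat \<Rightarrow> nat" where
  "nxt i u = (case (token_at i, token_at u) of (Extra q, Input a) \<Rightarrow> ix (Extra (\<delta> q a)) | _ \<Rightarrow> 0)"

text \<open>
  In the last step the flag is 0 and the weight 2 makes \<open>Accept\<close> beat the accepting state itself;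
  in all earlier steps the flag is at least \<open>1 / 2\<close> and the weight \<open>- 8\<close> rules \<open>Accept\<close> out.
\<close>

definition out_weights :: "'a token \<Rightarrow> rvec" where
  "out_weights \<sigma> = (\<lambda>j. case \<sigma> of
     Extra q \<Rightarrow> of_bool (j = 2 * V + ix (Extra q) \<or> q = q0 \<and> (j \<in> ix ` Input ` A \<or> j = ix Bos \<and> q0 \<notin> F))
   | Accept \<Rightarrow> (if j = 3 * V + 4 then - 8 else if j \<in> (\<lambda>q. 2 * V + ix (Extra q)) ` F then 2
                else of_bool (j = ix Bos \<and> q0 \<in> F))
   | _ \<Rightarrow> 0)"

definition dfa_transformer :: "'a transformer" where
  "dfa_transformer =
     \<lparr>n_heads = 1, n_layers = 2, dim = 2 * half_dim V, ff_width = V * V, n_extra = r,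
      emb = (\<lambda>\<sigma>. residual V (ix \<sigma>) (\<lambda>_. 0) (\<lambda>_. 0) 0 0 0 0), pos_enc = (\<lambda>_ _. 0),
      layers = (\<lambda>l. if l = 0 then count_layer V (ix Bos) (ix ` Input ` A)
                   else fetch_layer V (ix Bos) (ix ` Extra ` Q) nxt),
      out_map = out_weights\<rparr>"

lemma dfa_transformer_simps [simp]:
  "n_heads dfa_transformer = 1" "n_layers dfa_transformer = 2"
  "dim dfa_transformer = 2 * half_dim V" "ff_width dfa_transformer = V * V"
  "n_extra dfa_transformer = r" "pos_enc dfa_transformer = (\<lambda>_ _. 0)"
  "out_map dfa_transformer = out_weights"
  "emb dfa_transformer = (\<lambda>\<sigma>. residual V (ix \<sigma>) (\<lambda>_. 0) (\<lambda>_. 0) 0 0 0 0)"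
  "layers dfa_transformer 0 = count_layer V (ix Bos) (ix ` Input ` A)"
  "layers dfa_transformer (Suc l) = fetch_layer V (ix Bos) (ix ` Extra ` Q) nxt"
  by (simp_all add: dfa_transformer_def)

lemma vocab_simps [simp]:
  "Input a \<in> vocab A r \<longleftrightarrow> a \<in> A" "Bos \<in> vocab A r" "Accept \<in> vocab A r"
  "Extra q \<in> vocab A r \<longleftrightarrow> q < r"
  by (auto simp: vocab_def)

lemma ix_eq: "\<sigma> \<in> vocab A r \<Longrightarrow> \<tau> \<in> vocab A r \<Longrightarrow> ix \<sigma> = ix \<tau> \<longleftrightarrow> \<sigma> = \<tau>"
  using ix_inj by (auto dest: inj_onD)

lemma token_at_ix: "\<sigma> \<in> vocab A r \<Longrightarrow> token_at (ix \<sigma>) = \<sigma>"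
  unfolding token_at_def using ix_inj by (rule inv_into_f_f)

lemma nxt_ix: "q \<in> Q \<Longrightarrow> a \<in> A \<Longrightarrow> nxt (ix (Extra q)) (ix (Input a)) = ix (Extra (\<delta> q a))"
  using Q_less by (auto simp: nxt_def token_at_ix)

lemma params_in_dfa_transformer:
  assumes "float_format s p"
  shows "params_in A p dfa_transformer"
proof -
  interpret float_format s p by fact
  have "residual V (ix \<sigma>) (\<lambda>_. 0) (\<lambda>_. 0) 0 0 0 0 i \<in> floats p" for \<sigma> i
    by (intro residual_floats) auto
  moreover have "out_weights \<sigma> i \<in> floats p" for \<sigma> i
    by (auto simp: out_weights_def split: token.splits)
  moreover have "layer_in p dfa_transformer (count_layer V (ix Bos) (ix ` Input ` A))"
    unfolding layer_in_def head_in_def Let_def mat_in_def vec_in_def count_layer_def id_mat_def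
    by auto
  moreover have "layer_in p dfa_transformer (fetch_layer V (ix Bos) (ix ` Extra ` Q) nxt)"
    unfolding layer_in_def head_in_def Let_def mat_in_def vec_in_def fetch_layer_def id_mat_def
    by (auto simp: of_bool_def)
  ultimately show ?thesis
    unfolding params_in_def vec_in_def by (auto simp: less_2_cases_iff)
qed

end

text \<open>A machine whose initial state is its halting state stops after 0 steps. Its output tapes
  are still blank, and the blank tape encodes 0.\<close>

lemma log_time_computable_zero: "log_time_computable m (\<lambda>_ _. 0)"
proof -
  define M :: turing_machine where
    "M = \<lparr>tm_states = 1, tm_symbols = 4, tm_tapes = 2 * m + 1, tm_halt = 0, tm_delta = (\<lambda>_ _. (0, \<lambda>_. 0, \<lambda>_. Move_Stay))\<rparr>"
  have "tm_wf M" by (simp add: M_def tm_wf_def)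
  moreover have "int_code 0 = []" by (simp add: int_code_def nat_code.simps)
  ultimately show ?thesis unfolding log_time_computable_def
    by (intro exI[of _ M] exI[of _ "\<lambda>_. 0"]) (auto simp: M_def tm_init_def intro!: exI[of _ 0])
qed

section \<open>The intended run on a fixed input\<close>

locale dfa_run = dfa A Q \<delta> q0 F r V ix + attention_precision s p M
  for A :: "'a set" and Q \<delta> q0 F r V ix s p M +
  fixes x :: "'a list"
  assumes x: "x \<in> lists A" and M: "2 * (length x + 1) \<le> M"
begin

abbreviation "T \<equiv> dfa_transformer"

definition state :: "nat \<Rightarrow> nat" where
  "state k = foldl \<delta> q0 (take k x)"

text \<open>Meant for \<open>k \<le> length x\<close>: \<open>Accept\<close> can only be produced by
  the last step, so it never has to occur here.\<close>

definition toks :: "nat \<Rightarrow> 'a token list" where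
  "toks k = Bos # map Input x @ map (\<lambda>l. Extra (state l)) [0..<k]"

lemma state_in: "state k \<in> Q"
proof -
  have "foldl \<delta> q w \<in> Q" if "q \<in> Q" "w \<in> lists A" for q w
    using that by (induction w arbitrary: q) (auto simp: \<delta>)
  moreover have "take k x \<in> lists A" using x by (auto dest: in_set_takeD)
  ultimately show ?thesis unfolding state_def using q0 by blast
qed

lemma state_Suc: "k < length x \<Longrightarrow> state (Suc k) = \<delta> (state k) (x ! k)"
  by (simp add: state_def take_Suc_conv_app_nth)

lemma x_nth: "k < length x \<Longrightarrow> x ! k \<in> A"
  using x by auto

lemma length_toks [simp]: "length (toks k) = length x + 1 + k"
  by (simp add: toks_def)

lemma toks_nth:
  "toks k ! 0 = Bos"
  "1 \<le> j \<Longrightarrow> j \<le> length x \<Longrightarrow> toks k ! j = Input (x ! (j - 1))"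
  "length x < j \<Longrightarrow> j \<le> length x + k \<Longrightarrow> toks k ! j = Extra (state (j - length x - 1))"
  by (auto simp: toks_def nth_Cons' nth_append)

lemma M_less: "real M < 2 ^ s"
proof -
  have "real M \<le> (real M)\<^sup>2" using M_ge by (simp add: power2_eq_square)
  moreover have "0 < (real M)\<^sup>2" using M_ge by simp
  ultimately show ?thesis using M_sq(1) by linarith
qed

lemma nat_floats: "m \<le> M \<Longrightarrow> real m \<in> floats p"
proof -
  assume "m \<le> M"
  then have "real m < 2 ^ s" using M_less by simp
  then have "int m < 2 ^ s" by (metis of_int_less_iff of_int_numeral of_int_of_nat_eq of_int_power)
  then show ?thesis using of_int_floats[of "int m"] by simp
qed

end

locale dfa_step = dfa_run A Q \<delta> q0 F r V ix s p M x
  for A :: "'a set" and Q \<delta> q0 F r V ix s p M x +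
  fixes k :: nat
  assumes k: "k \<le> length x"
begin

definition tk :: "nat \<Rightarrow> nat" where
  "tk j = ix (toks k ! (j - 1))"

abbreviation "a \<equiv> avg (\<lambda>j. of_bool (tk j = ix Bos))"
abbreviation "c \<equiv> avg (\<lambda>j. of_bool (tk j \<notin> ix ` Input ` A))"
abbreviation "d \<equiv> avg (\<lambda>j. if tk j \<in> ix ` Input ` A then 1 else - 1)"

lemma tk_less [simp]: "tk j < V"
  by (simp add: tk_def ix_less)

lemma V_pos: "0 < V"
  using ix_less[of Bos] by simp

lemma hidden_1:
  "hidden p T (toks k) 1 = (\<lambda>i. residual V (tk i) (\<lambda>_. 0) (\<lambda>_. 0) (a i) (c i) (d i) (flag (d i)))"
proof -
  have h0: "hidden p T (toks k) 0 = (\<lambda>j. residual V (tk j) (\<lambda>_. 0) (\<lambda>_. 0) 0 0 0 0)"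
    unfolding hidden.simps vadd_def tk_def
    by (auto simp: fun_eq_iff intro!: tr_id residual_floats)
  show ?thesis
    unfolding One_nat_def hidden.simps(2) h0 dfa_transformer_simps
  proof (rule ext)
    fix i
    show "ff_sublayer p T (count_layer V (ix Bos) (ix ` Input ` A))
        (attn_sublayer p T (count_layer V (ix Bos) (ix ` Input ` A))
          (\<lambda>j. residual V (tk j) (\<lambda>_. 0) (\<lambda>_. 0) 0 0 0 0) i) =
      residual V (tk i) (\<lambda>_. 0) (\<lambda>_. 0) (a i) (c i) (d i) (flag (d i))"
      by (subst count_attn) (simp_all add: count_ff V_pos)
  qed
qed

lemma hidden_2:
  "hidden p T (toks k) 2 i = ff_sublayer p T (fetch_layer V (ix Bos) (ix ` Extra ` Q) nxt)
     (residual V (tk i) (fetched (ix Bos) tk a c i) (\<lambda>_. 0) (a i) (c i) (d i) (flag (d i)))"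
  unfolding numeral_2_eq_2 hidden.simps(2)[of p T "toks k" "Suc 0"] hidden_1[unfolded One_nat_def] dfa_transformer_simps
  by (subst fetch_attn) (auto simp: ix_less)

lemma hidden_2_no_state:
  assumes "tk i \<notin> ix ` Extra ` Q"
  shows "hidden p T (toks k) 2 i =
    residual V (tk i) (fetched (ix Bos) tk a c i) (\<lambda>_. 0) (a i) (c i) (d i) (flag (d i))"
  unfolding hidden_2 using assms by (intro fetch_ff) (auto simp: fetched_bounds)

section \<open>Token counts before a position\<close>

definition cnt :: "nat \<Rightarrow> nat" where
  "cnt i = card {j \<in> {1..<i}. tk j \<notin> ix ` Input ` A}"

lemma tk_1: "tk 1 = ix Bos"
  using toks_nth(1)[of k] by (simp add: tk_def)

lemma tk_cases:
  "2 \<le> j \<Longrightarrow> j \<le> length x + 1 \<Longrightarrow> tk j = ix (Input (x ! (j - 2)))"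
  "length x + 1 < j \<Longrightarrow> j \<le> length x + 1 + k \<Longrightarrow> tk j = ix (Extra (state (j - length x - 2)))"
  using toks_nth(2)[of "j - 1" k] toks_nth(3)[of "j - 1" k]
  by (auto simp: tk_def numeral_2_eq_2)

lemma state_less [simp]: "state l < r"
  using state_in Q_less by auto

lemma tk_bos: "1 \<le> j \<Longrightarrow> j \<le> length x + 1 + k \<Longrightarrow> tk j = ix Bos \<longleftrightarrow> j = 1"
proof -
  assume j: "1 \<le> j" "j \<le> length x + 1 + k"
  then consider "j = 1" | "2 \<le> j" "j \<le> length x + 1" | "length x + 1 < j" by linarith
  then show ?thesis using tk_1 tk_cases[of j] j by cases (auto simp: ix_eq x_nth)
qed

lemma tk_input: "1 \<le> j \<Longrightarrow> j \<le> length x + 1 + k \<Longrightarrow>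
    tk j \<in> ix ` Input ` A \<longleftrightarrow> 2 \<le> j \<and> j \<le> length x + 1"
proof -
  assume j: "1 \<le> j" "j \<le> length x + 1 + k"
  have in_iff: "ix \<sigma> \<in> ix ` Input ` A \<longleftrightarrow> \<sigma> \<in> Input ` A" if "\<sigma> \<in> vocab A r" for \<sigma>
    using that ix_eq by (auto simp: image_iff)
  from j consider "j = 1" | "2 \<le> j" "j \<le> length x + 1" | "length x + 1 < j" by linarith
  then show ?thesis using tk_1 tk_cases[of j] j
    by cases (auto simp: in_iff x_nth)
qed

lemma sum_bos: "2 \<le> i \<Longrightarrow> i \<le> length x + 1 + k \<Longrightarrow> (\<Sum>j\<in>{1..<i}. of_bool (tk j = ix Bos)) = (1 :: real)"
proof -
  assume i: "2 \<le> i" "i \<le> length x + 1 + k"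
  have "(\<Sum>j\<in>{1..<i}. of_bool (tk j = ix Bos)) = (\<Sum>j\<in>{1..<i}. of_bool (j = 1) :: real)"
    using i tk_bos by (intro sum.cong) auto
  also have "\<dots> = (\<Sum>j\<in>{1::nat}. 1)" using i by (intro sum.mono_neutral_cong_right) auto
  finally show ?thesis by simp
qed

lemma sum_cnt: "(\<Sum>j\<in>{1..<i}. of_bool (tk j \<notin> ix ` Input ` A)) = real (cnt i)"
proof -
  have "(\<Sum>j\<in>{1..<i}. of_bool (tk j \<notin> ix ` Input ` A) :: real) = (\<Sum>j\<in>{j \<in> {1..<i}. tk j \<notin> ix ` Input ` A}. 1)"
    by (intro sum.mono_neutral_cong_right) auto
  then show ?thesis by (simp add: cnt_def)
qed

lemma cnt_le: "cnt i \<le> i - 1"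
proof -
  have "{j \<in> {1..<i}. tk j \<notin> ix ` Input ` A} \<subseteq> {1..<i}" by auto
  from card_mono[OF _ this] show ?thesis by (simp add: cnt_def)
qed

text \<open>Up to position \<open>length x + 2\<close>, that of the first generated token, only
  \<open>Bos\<close> is counted. There \<open>a\<close> and \<open>c\<close> agree, as the sharp
  norm requires; each later position counts one more state.\<close>

lemma cnt_eq:
  assumes "2 \<le> i" "i \<le> length x + 1 + k"
  shows "cnt i = (if i \<le> length x + 2 then 1 else i - length x - 1)"
proof -
  have "j \<in> {1..<i} \<Longrightarrow> tk j \<notin> ix ` Input ` A \<longleftrightarrow> \<not> (2 \<le> j \<and> j \<le> length x + 1)" for j
    using tk_input[of j] assms by simp
  then have "{j \<in> {1..<i}. tk j \<notin> ix ` Input ` A} = {j \<in> {1..<i}. \<not> (2 \<le> j \<and> j \<le> length x + 1)}"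
    by blast
  also have "\<dots> = insert 1 {length x + 2..<i}" using assms by auto
  finally show ?thesis using assms by (auto simp: cnt_def)
qed

lemma sum_diff: "(\<Sum>j\<in>{1..<i}. if tk j \<in> ix ` Input ` A then 1 else - 1) = real (i - 1) - 2 * real (cnt i)"
proof -
  have "(\<Sum>j\<in>{1..<i}. if tk j \<in> ix ` Input ` A then 1 else - 1 :: real) =
      (\<Sum>j\<in>{1..<i}. 1 - 2 * of_bool (tk j \<notin> ix ` Input ` A))"
    by (intro sum.cong) auto
  also have "\<dots> = (\<Sum>j\<in>{1..<i}. 1) - 2 * (\<Sum>j\<in>{1..<i}. of_bool (tk j \<notin> ix ` Input ` A))"
    by (simp only: sum_subtractf sum_distrib_left)
  finally show ?thesis unfolding sum_cnt by simp
qed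

lemma a_eq: "2 \<le> i \<Longrightarrow> i \<le> length x + 1 + k \<Longrightarrow> a i = tr (1 / real (i - 1))"
  unfolding avg_def by (subst sum_bos) auto

text \<open>Counts are below \<open>2 ^ s\<close> and hence floats, so only the division is
  rounded.\<close>

lemma c_eq: "i \<le> length x + 1 + k \<Longrightarrow> c i = tr (real (cnt i) / real (i - 1))"
  unfolding avg_def sum_cnt using cnt_le[of i] M k by (subst tr_id[OF nat_floats]) auto

lemma d_eq:
  assumes "1 \<le> k"
  shows "d (length x + 1 + k) = tr (real (length x - k) / real (length x + k))"
proof -
  have "cnt (length x + 1 + k) = k" using assms k by (subst cnt_eq) auto
  then have "(\<Sum>j\<in>{1..<length x + 1 + k}. if tk j \<in> ix ` Input ` A then 1 else - 1) = real (length x - k)"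
    unfolding sum_diff using k by simp
  moreover have "real (length x - k) \<in> floats p" using M by (intro nat_floats) simp
  ultimately show ?thesis unfolding avg_def by simp
qed

lemma next_token_eq:
  assumes "\<sigma> \<in> vocab A r" "\<And>\<tau>. \<tau> \<in> vocab A r \<Longrightarrow> \<tau> \<noteq> \<sigma> \<Longrightarrow>
     dot p (2 * half_dim V) (out_weights \<tau>) (hidden p T (toks k) 2 (length x + 1 + k))
   < dot p (2 * half_dim V) (out_weights \<sigma>) (hidden p T (toks k) 2 (length x + 1 + k))"
  shows "next_token A p T (toks k) = \<sigma>"
  unfolding next_token_def using assms by (intro arg_max_eq) auto

end

section \<open>Decoding\<close>

context attention_precision
begin

text \<open>The exact quotient is \<open>1 / sqrt 2\<close>, well inside \<open>[1/2, 1]\<close>.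
  Two roundings of relative error \<open>1/100\<close> cannot push the doubled square out of the
  range from \<open>d^2\<close> to \<open>4 * d^2\<close>, so the norm lies between \<open>d\<close>
  and \<open>2 * d\<close>.\<close>

lemma flag_bounds:
  assumes "d \<in> floats p" "1 / (2 * real M) \<le> d" "d \<le> 1"
  shows "1/2 \<le> flag d" "flag d \<le> 1"
proof -
  have d0: "0 < d"
  proof -
    have "0 < 1 / (2 * real M)" using M_ge by simp
    then show ?thesis using assms(2) by linarith
  qed
  have dd1: "d * d \<le> 1" using d0 assms by (intro mult_le_one) auto
  have "1 / (2 * real M) * (1 / (2 * real M)) \<le> d * d" using assms d0 by (intro mult_mono) auto
  moreover have "1 / (72 * (real M)\<^sup>2) \<le> 1 / (2 * real M) * (1 / (2 * real M))"
    using M_ge by (simp add: field_simps power2_eq_square)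
  ultimately have low: "1 / (72 * (real M)\<^sup>2) \<le> d * d" by linarith
  define y where "y = tr (d * d)"
  have e: "99/100 \<le> eta" "eta \<le> 1" by (fact eta_bounds)+
  have y: "eta * (d * d) \<le> y" "y \<le> d * d" "0 \<le> y"
    unfolding y_def using low dd1 by (auto intro!: tr_relM tr_nonneg)
  have "99/100 * (d * d) \<le> eta * (d * d)" using e by (intro mult_right_mono) auto
  then have y2: "99/100 * (d * d) \<le> y" using y by linarith
  have "eta * (2 * y) \<le> tr (2 * y)" using y y2 low dd1 by (intro tr_relM) linarith+
  moreover have "99/100 * (2 * y) \<le> eta * (2 * y)" using e y by (intro mult_right_mono) auto
  moreover have "0 \<le> d * d" using d0 by simp
  ultimately have z: "d * d \<le> tr (2 * y)" using y2 by linarith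
  have zu: "tr (2 * y) \<le> 4 * (d * d)" using tr_nonneg(3)[of "2 * y"] y \<open>0 \<le> d * d\<close> by linarith
  have s1: "d \<le> sqrt (tr (2 * y))" using z by (intro real_le_rsqrt) (simp add: power2_eq_square)
  have s2: "sqrt (tr (2 * y)) \<le> 2 * d" using zu d0 by (intro real_le_lsqrt) (simp_all add: power2_eq_square)
  define n where "n = tr (sqrt (tr (2 * y)))"
  have n1: "d \<le> n" unfolding n_def using s1 assms(1) by (intro tr_ge)
  have n2: "n \<le> 2 * d" unfolding n_def using tr_nonneg(3)[of "sqrt (tr (2 * y))"] s1 s2 d0 by linarith
  have "1/2 \<le> d / n" "d / n \<le> 1" using n1 n2 d0 by (auto simp: field_simps)
  then have "1/2 \<le> tr (d / n)" "tr (d / n) \<le> 1"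
    using tr_ge[OF floats_half(1)] tr_le[OF floats_simps(2)] by blast+
  then show "1/2 \<le> flag d" "flag d \<le> 1" using d0 unfolding flag_def n_def y_def by auto
qed

lemma flag_nonneg: "0 \<le> flag d"
  by (simp add: flag_def)

text \<open>The squares of the own token, of \<open>\<rho>\<close> and of \<open>e\<close> add up to
  at most 3, so the norm is at most \<open>sqrt 6 < 3\<close>. The quotient by 4 instead of 3
  provides a representable lower bound.\<close>

lemma gate_bounds:
  fixes a c d :: real and z :: "nat \<Rightarrow> real"
  assumes t: "t < V" and u: "u < V" and rho: "\<rho> \<in> floats p" "1/4 \<le> \<rho>" "\<rho> \<le> 1"
    and e: "0 \<le> e" "e \<le> 1"
  defines "n \<equiv> sel_norm ({..<2 * V} \<union> {3 * V + 4}) (residual V t (\<lambda>i. if i = u then \<rho> else 0) z a c d e)"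
  shows "1/16 \<le> tr (\<rho> / n)" "tr (\<rho> / n) \<le> 1"
proof -
  let ?K = "{..<2 * V} \<union> {3 * V + 4}" and ?v = "residual V t (\<lambda>i. if i = u then \<rho> else 0) z a c d e"
  have n1: "1 \<le> n" unfolding n_def using t by (intro sel_norm_ge_1[of _ t]) (auto simp: residual_def)
  have "(\<Sum>i\<in>?K. tr (?v i * ?v i)) = (\<Sum>i\<in>{t, V + u, 3 * V + 4}. tr (?v i * ?v i))"
    using t u by (intro sum.mono_neutral_right) (auto simp: residual_def)
  also have "\<dots> = 1 + tr (\<rho> * \<rho>) + tr (e * e)" using t u by (simp add: residual_def)
  also have "\<dots> \<le> 3"
  proof -
    have "tr (\<rho> * \<rho>) \<le> 1" "tr (e * e) \<le> 1"
      using rho e by (auto intro!: tr_le mult_le_one)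
    then show ?thesis by simp
  qed
  finally have S: "(\<Sum>i\<in>?K. tr (?v i * ?v i)) \<le> 3" .
  have S0: "0 \<le> (\<Sum>i\<in>?K. tr (?v i * ?v i))" by (intro sum_nonneg tr_nonneg) auto
  have "tr (2 * (\<Sum>i\<in>?K. tr (?v i * ?v i))) \<le> 9"
    using S S0 tr_nonneg(3)[of "2 * (\<Sum>i\<in>?K. tr (?v i * ?v i))"] by linarith
  then have "sqrt (tr (2 * (\<Sum>i\<in>?K. tr (?v i * ?v i)))) \<le> 3"
    using real_sqrt_le_mono by fastforce
  moreover have "0 \<le> sqrt (tr (2 * (\<Sum>i\<in>?K. tr (?v i * ?v i))))"
    using S0 by (intro real_sqrt_ge_zero tr_nonneg) simp
  ultimately have n3: "n \<le> 3" unfolding n_def sel_norm_def using tr_nonneg(3) order_trans by blast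
  have "1/4 / 4 \<le> \<rho> / n" using rho n1 n3 by (intro frac_le) auto
  moreover have "\<rho> / n \<le> 1" using rho n1 by simp
  ultimately show "1/16 \<le> tr (\<rho> / n)" "tr (\<rho> / n) \<le> 1"
    using tr_ge[OF floats_half(3), of "\<rho> / n"] tr_le[OF floats_simps(2)] by auto
qed

end

section \<open>Comparison of the output scores\<close>

context dfa_step
begin

lemma out_other:
  "\<tau> \<noteq> Accept \<Longrightarrow> (\<And>q. \<tau> \<noteq> Extra q) \<Longrightarrow> dot p m (out_weights \<tau>) v = 0"
  by (cases \<tau>) (auto intro!: dot_zero simp: out_weights_def)

lemma out_weights_Extra_ge:
  assumes "V \<le> j"
  shows "out_weights (Extra q) j = of_bool (j = 2 * V + ix (Extra q))"
proof -
  have "j \<notin> ix ` Input ` A" using assms ix_less by (metis imageE leD)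
  moreover have "j \<noteq> ix Bos" using assms ix_less[of Bos] by simp
  ultimately show ?thesis by (simp add: out_weights_def)
qed

lemma out_extra_start:
  assumes "t < V"
  shows "dot p (2 * half_dim V) (out_weights (Extra q)) (residual V t f (\<lambda>_. 0) a' c' d' e) =
    of_bool (q = q0 \<and> (t \<in> ix ` Input ` A \<or> t = ix Bos \<and> q0 \<notin> F))"
proof -
  let ?v = "residual V t f (\<lambda>_. 0) a' c' d' e"
  have "dot p (2 * half_dim V) (out_weights (Extra q)) ?v = tr (out_weights (Extra q) t * ?v t)"
  proof (rule dot_single)
    fix j assume j: "j \<noteq> t"
    show "out_weights (Extra q) j * ?v j = 0"
    proof (cases "j < V")
      case False
      then show ?thesis using out_weights_Extra_ge[of j q] ix_less[of "Extra q"] by (auto simp: residual_def)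
    qed (use j in \<open>simp add: residual_def\<close>)
  qed (use assms in simp)
  then show ?thesis using assms by (simp add: out_weights_def residual_def)
qed

lemma out_weights_Accept:
  "j < V \<Longrightarrow> out_weights Accept j = of_bool (j = ix Bos \<and> q0 \<in> F)"
  "V \<le> j \<Longrightarrow> j \<noteq> 3 * V + 4 \<Longrightarrow>
    out_weights Accept j = (if j \<in> (\<lambda>q. 2 * V + ix (Extra q)) ` F then 2 else 0)"
  "out_weights Accept (3 * V + 4) = - 8"
  using ix_less[of Bos] by (auto simp: out_weights_def)

lemma out_weights_Accept_0:
  assumes "V \<le> j" "j \<noteq> 3 * V + 4" "\<not> (2 * V \<le> j \<and> j < 3 * V)"
  shows "out_weights Accept j = 0"
proof -
  have "2 * V + ix (Extra q) < 3 * V" for q using ix_less[of "Extra q"] by simp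
  then have "j \<notin> (\<lambda>q. 2 * V + ix (Extra q)) ` F" using assms(3) by auto
  then show ?thesis using assms(1,2) by (simp add: out_weights_Accept)
qed

lemma out_accept_start:
  assumes "t < V"
  shows "dot p (2 * half_dim V) (out_weights Accept) (residual V t f (\<lambda>_. 0) a' c' d' e) =
    tr (tr (- 8 * e) + of_bool (t = ix Bos \<and> q0 \<in> F))"
proof -
  let ?v = "residual V t f (\<lambda>_. 0) a' c' d' e"
  have "dot p (2 * half_dim V) (out_weights Accept) ?v =
      tr (tr (out_weights Accept (3 * V + 4) * ?v (3 * V + 4)) + tr (out_weights Accept t * ?v t))"
  proof (rule dot_two)
    fix j assume j: "j \<noteq> 3 * V + 4" "j \<noteq> t"
    show "out_weights Accept j * ?v j = 0"
    proof (cases "j < V \<or> 2 * V \<le> j \<and> j < 3 * V")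
      case False
      then show ?thesis using j out_weights_Accept_0[of j] by auto
    qed (use j in \<open>auto simp: residual_def\<close>)
  qed (use assms in auto)
  moreover have "?v (3 * V + 4) = e" "?v t = 1" using assms by (simp_all add: residual_def)
  ultimately show ?thesis using assms by (simp add: out_weights_Accept)
qed

text \<open>No state has been generated yet, so the last token itself must trigger the output: a
  letter calls for \<open>q0\<close>. For \<open>x = []\<close> the last token is \<open>Bos\<close>
  and this step is also the final one, so membership of \<open>q0\<close> in \<open>F\<close> is
  built into the weights at \<open>Bos\<close>.\<close>

lemma next_token_start:
  assumes k0: "k = 0"
  shows "next_token A p T (toks k) = (if x = [] \<and> q0 \<in> F then Accept else Extra q0)"
proof (rule next_token_eq)
  let ?i = "length x + 1 + k"
  have q0r: "q0 < r" using q0 Q_less by auto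
  then show "(if x = [] \<and> q0 \<in> F then Accept else Extra q0) \<in> vocab A r" by simp
  have t: "tk ?i \<in> ix ` Input ` A \<longleftrightarrow> x \<noteq> []" "tk ?i = ix Bos \<longleftrightarrow> x = []"
    using tk_input[of ?i] tk_bos[of ?i] k0 by (auto simp: Suc_le_eq)
  have ns: "tk ?i \<notin> ix ` Extra ` Q"
  proof (cases "x = []")
    case True
    then show ?thesis using t Q_less by (auto simp: ix_eq)
  next
    case False
    then obtain b where "b \<in> A" "tk ?i = ix (Input b)" using t by auto
    then show ?thesis using Q_less by (auto simp: ix_eq)
  qed
  note h = hidden_2_no_state[OF ns]
  \<comment> \<open>For the empty input this is position 1, where the average defaults to 0.\<close>
  have e0: "flag (d ?i) = 0" if "x = []" using that k0 by (simp add: avg_def flag_def)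
  have acc: "dot p (2 * half_dim V) (out_weights Accept) (hidden p T (toks k) 2 ?i) =
      (if x = [] then of_bool (q0 \<in> F) else tr (tr (- 8 * flag (d ?i))))"
    unfolding h using e0 t by (subst out_accept_start) auto
  have neg: "tr (tr (- 8 * flag (d ?i))) \<le> 0"
    using flag_nonneg[of "d ?i"] by (intro tr_le) auto
  fix \<tau> assume \<tau>: "\<tau> \<in> vocab A r" "\<tau> \<noteq> (if x = [] \<and> q0 \<in> F then Accept else Extra q0)"
  have ext: "dot p (2 * half_dim V) (out_weights (Extra q)) (hidden p T (toks k) 2 ?i) =
      of_bool (q = q0 \<and> (x \<noteq> [] \<or> q0 \<notin> F))" for q
    unfolding h using t by (subst out_extra_start) auto
  show "dot p (2 * half_dim V) (out_weights \<tau>) (hidden p T (toks k) 2 ?i) <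
    dot p (2 * half_dim V) (out_weights (if x = [] \<and> q0 \<in> F then Accept else Extra q0)) (hidden p T (toks k) 2 ?i)"
  proof (cases \<tau>)
    case Accept
    then show ?thesis using \<tau> acc ext neg by (auto split: if_splits)
  next
    case (Extra q)
    then show ?thesis using \<tau> acc ext by (auto split: if_splits)
  qed (use \<tau> acc ext out_other in \<open>auto split: if_splits\<close>)
qed

text \<open>The current position has \<open>length x + k\<close> predecessors, \<open>k\<close> of
  them non-input, so the query has direction \<open>(1, k)\<close>. Position \<open>k + 1\<close>
  carries the \<open>k\<close>-th letter and has \<open>k\<close> predecessors.\<close>

lemma fetch_set_eq:
  assumes k1: "1 \<le> k"
  shows "fetch_set (\<lambda>j. tk j = ix Bos) a c (length x + 1 + k) = {k + 1}"
proof -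
  define N where "N = length x + k"
  have i: "length x + 1 + k = Suc N" by (simp add: N_def)
  have ai: "a (Suc N) = tr (1 / real N)" using a_eq[of "Suc N"] k1 by (simp add: N_def)
  have "cnt (Suc N) = k" using k1 k by (subst cnt_eq) (auto simp: N_def)
  then have ci: "c (Suc N) = tr (real k / real N)" using c_eq[of "Suc N"] by (simp add: N_def)
  have NM: "N \<le> M" using M k by (simp add: N_def)
  have kN: "k \<le> N" by (simp add: N_def)
  have ak: "a (Suc k) = tr (1 / real k)" using a_eq[of "Suc k"] k1 k by simp
  have "cnt (Suc k) = 1" using k1 k by (subst cnt_eq) auto
  then have ck: "c (Suc k) = tr (1 / real k)" using c_eq[of "Suc k"] k1 k by simp
  have bk: "tk (Suc k) \<noteq> ix Bos" using tk_bos[of "Suc k"] k1 k by simp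
  let ?f = "fetch_score (\<lambda>j. tk j = ix Bos) a c (Suc N)"
  have pos: "0 < ?f (Suc k)"
    using score_less(2)[of "Suc k" k N 1] k1 kN NM k bk M
    unfolding fetch_score_def ai ci ak ck by simp
  have "is_arg_max ?f (\<lambda>j. j \<in> {1..<Suc N}) j \<longleftrightarrow> j = Suc k" for j
  proof (rule is_arg_max_iff)
    \<comment> \<open>Strict causality requires \<open>k < N\<close>; this holds as \<open>x\<close>
      is nonempty.\<close>
    show "Suc k \<in> {1..<Suc N}" using k1 k by (cases x) (auto simp: N_def)
    fix j assume j: "j \<in> {1..<Suc N}" "j \<noteq> Suc k"
    show "?f j < ?f (Suc k)"
    proof (cases "j = 1")
      case True
      \<comment> \<open>\<open>Bos\<close> has no predecessors, and its second key entry is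
        cancelled; its key is 0 and loses against any positive score.\<close>
      have "a 1 = 0" by (simp add: avg_def)
      then have "?f 1 = 0" using tk_1 by (simp add: fetch_score_def score_def)
      then show ?thesis using pos True by simp
    next
      case False
      define l where "l = j - 1"
      have jl: "j = Suc l" and l: "1 \<le> l" "l \<noteq> k" "l < N" using j False by (auto simp: l_def)
      have aj: "a (Suc l) = tr (1 / real l)" using a_eq[of "Suc l"] l by (simp add: N_def)
      have cj: "c (Suc l) = tr (real (cnt (Suc l)) / real l)" using c_eq[of "Suc l"] l by (simp add: N_def)
      have cnt: "1 \<le> cnt (Suc l)" using l by (subst cnt_eq) (auto simp: N_def)
      have cnt2: "cnt (Suc l) \<le> l" using cnt_le[of "Suc l"] by simp
      have bj: "tk (Suc l) \<noteq> ix Bos" using tk_bos[of "Suc l"] l by (simp add: N_def)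
      show ?thesis unfolding jl
        using score_less(1)[OF l(2,1) _ k1 kN NM cnt cnt2] l NM bj bk
        unfolding fetch_score_def ai ci ak ck aj cj by simp
    qed
  qed
  then show ?thesis unfolding fetch_set_def i by auto
qed

lemma out_extra_state:
  assumes t: "t \<in> ix ` Extra ` Q" and q': "q' < r" and q: "q < r" and g: "g \<in> floats p"
  shows "dot p (2 * half_dim V) (out_weights (Extra q))
      (residual V t f (\<lambda>i. if i = ix (Extra q') then g else 0) a' c' d' e) = (if q = q' then g else 0)"
proof -
  let ?v = "residual V t f (\<lambda>i. if i = ix (Extra q') then g else 0) a' c' d' e"
  have t': "t < V" "t \<notin> ix ` Input ` A" "t \<noteq> ix Bos" using t ix_less Q_less by (auto simp: ix_eq)
  have "dot p (2 * half_dim V) (out_weights (Extra q)) ?v =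
      tr (out_weights (Extra q) (2 * V + ix (Extra q')) * ?v (2 * V + ix (Extra q')))"
  proof (rule dot_single)
    show "2 * V + ix (Extra q') < 2 * half_dim V" using ix_less[of "Extra q'"] by simp
    fix j assume j: "j \<noteq> 2 * V + ix (Extra q')"
    show "out_weights (Extra q) j * ?v j = 0"
    proof (cases "j < V")
      case True
      then show ?thesis using t' ix_less[of "Extra q"] by (auto simp: residual_def out_weights_def)
    next
      case False
      then show ?thesis using out_weights_Extra_ge[of j q] ix_less[of "Extra q"] j
        by (auto simp: residual_def)
    qed
  qed
  moreover have "?v (2 * V + ix (Extra q')) = g" using ix_less[of "Extra q'"] by (simp add: residual_def)
  moreover have "out_weights (Extra q) (2 * V + ix (Extra q')) = of_bool (q = q')"
    using q q' by (simp add: out_weights_Extra_ge ix_eq eq_commute)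
  ultimately show ?thesis using g by simp
qed

lemma out_accept_state:
  assumes t: "t \<in> ix ` Extra ` Q" and q': "q' \<in> Q"
  shows "dot p (2 * half_dim V) (out_weights Accept)
      (residual V t f (\<lambda>i. if i = ix (Extra q') then g else 0) a' c' d' e) =
    tr (tr (- 8 * e) + tr (of_bool (q' \<in> F) * (2 * g)))"
proof -
  let ?v = "residual V t f (\<lambda>i. if i = ix (Extra q') then g else 0) a' c' d' e"
  have t': "t < V" "t \<noteq> ix Bos" using t ix_less Q_less by (auto simp: ix_eq)
  have "dot p (2 * half_dim V) (out_weights Accept) ?v =
      tr (tr (out_weights Accept (3 * V + 4) * ?v (3 * V + 4)) +
          tr (out_weights Accept (2 * V + ix (Extra q')) * ?v (2 * V + ix (Extra q'))))"
  proof (rule dot_two)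
    fix j assume j: "j \<noteq> 3 * V + 4" "j \<noteq> 2 * V + ix (Extra q')"
    show "out_weights Accept j * ?v j = 0"
    proof (cases "j < V")
      case True
      then show ?thesis using t' by (simp add: out_weights_Accept residual_def)
    next
      case False
      then show ?thesis using j out_weights_Accept_0[of j]
        by (cases "2 * V \<le> j \<and> j < 3 * V") (auto simp: residual_def)
    qed
  qed (use ix_less[of "Extra q'"] in auto)
  moreover have "?v (2 * V + ix (Extra q')) = g" using ix_less[of "Extra q'"] by (simp add: residual_def)
  moreover have "2 * V + ix (Extra q') \<in> (\<lambda>q. 2 * V + ix (Extra q)) ` F \<longleftrightarrow> q' \<in> F"
    using q' F Q_less by (auto simp: ix_eq image_iff subset_iff)
  then have "out_weights Accept (2 * V + ix (Extra q')) = 2 * of_bool (q' \<in> F)"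
    using ix_less[of "Extra q'"] by (subst out_weights_Accept(2)) auto
  moreover have "out_weights Accept (3 * V + 4) = - 8" "?v (3 * V + 4) = e"
    by (simp_all add: out_weights_Accept residual_def)
  ultimately show ?thesis by (simp add: mult.assoc mult.left_commute)
qed

text \<open>The next state scores \<open>g\<close> and all other states 0. \<open>Accept\<close>
  scores about \<open>2 * g\<close> in the last step if the state accepts, exactly 0 in the last
  step otherwise, and at most 0 in earlier steps.\<close>

lemma next_token_state:
  assumes k1: "1 \<le> k"
  shows "next_token A p T (toks k) = (if k = length x \<and> state k \<in> F then Accept else Extra (state k))"
proof (rule next_token_eq)
  let ?i = "length x + 1 + k"
  let ?y = "if k = length x \<and> state k \<in> F then Accept else Extra (state k)"
  show "?y \<in> vocab A r" by simp
  define q where "q = state (k - 1)"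
  define b where "b = x ! (k - 1)"
  have q: "q \<in> Q" unfolding q_def by (rule state_in)
  have b: "b \<in> A" using x_nth[of "k - 1"] k k1 by (simp add: b_def)
  have ti: "tk ?i = ix (Extra q)" using tk_cases(2)[of ?i] k1 by (simp add: q_def)
  have tb: "tk (k + 1) = ix (Input b)" using tk_cases(1)[of "k + 1"] k1 k by (simp add: b_def)
  have sk: "\<delta> q b = state k" using state_Suc[of "k - 1"] k k1 by (simp add: q_def b_def)
  define \<rho> where "\<rho> = tr (1 / nu (a (k + 1)) (c (k + 1)))"
  \<comment> \<open>With a single attended position the average is exact.\<close>
  have f: "fetched (ix Bos) tk a c ?i = (\<lambda>u. if u = ix (Input b) then \<rho> else 0)"
    using k1 by (auto simp: fetched_def Let_def fetch_set_eq[OF k1, simplified] tb[simplified] \<rho>_def)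
  have \<rho>: "\<rho> \<in> floats p" "1/4 \<le> \<rho>" "\<rho> \<le> 1"
  proof -
    have "cnt (k + 1) = 1" using k1 k by (subst cnt_eq) auto
    then have "c (k + 1) = tr (real 1 / real k)" "a (k + 1) = tr (1 / real k)"
      using c_eq[of "k + 1"] a_eq[of "k + 1"] k1 k by auto
    then have n: "nu (a (k + 1)) (c (k + 1)) \<le> 3" using nu_bounds(2)[of 1 k] k1 k M by simp
    have n1: "1 \<le> nu (a (k + 1)) (c (k + 1))" by (rule nu_ge_1)
    show "\<rho> \<in> floats p" by (simp add: \<rho>_def)
    \<comment> \<open>The natural bound \<open>1/3\<close> is not a float and might be lost in
      truncation; \<open>1/4\<close> is.\<close>
    have "1/4 \<le> 1 / nu (a (k + 1)) (c (k + 1))" using n n1 by (intro frac_le) auto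
    then show "1/4 \<le> \<rho>" unfolding \<rho>_def by (intro tr_ge) auto
    have "1 / nu (a (k + 1)) (c (k + 1)) \<le> 1" using n1 by simp
    then show "\<rho> \<le> 1" unfolding \<rho>_def by (intro tr_le) auto
  qed
  define e where "e = flag (d ?i)"
  have e: "if k = length x then e = 0 else 1/2 \<le> e \<and> e \<le> 1"
  proof (cases "k = length x")
    case True
    then show ?thesis using d_eq[OF k1] by (simp add: e_def flag_def)
  next
    case False
    define N where "N = length x + k"
    have N: "1 \<le> length x - k" "length x - k \<le> N" "1 \<le> N" "N \<le> M" using k k1 False M by (auto simp: N_def)
    have "1 / (2 * real M) \<le> 1 / (2 * real N)" using N by (intro divide_left_mono) auto
    then have "1 / (2 * real M) \<le> d ?i" "d ?i \<le> 1"
      using avg_bounds(3,4)[OF N] unfolding d_eq[OF k1] N_def by linarith+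
    then show ?thesis using flag_bounds[of "d ?i"] False by (simp add: e_def)
  qed
  define v where "v = residual V (tk ?i) (\<lambda>u. if u = ix (Input b) then \<rho> else 0) (\<lambda>_. 0) (a ?i) (c ?i) (d ?i) e"
  define g where "g = tr (\<rho> / sel_norm ({..<2 * V} \<union> {3 * V + 4}) v)"
  have g: "1/16 \<le> g" "g \<le> 1" "g \<in> floats p"
  proof -
    have "0 \<le> e" "e \<le> 1" using e by (auto split: if_splits)
    then show "1/16 \<le> g" "g \<le> 1" using gate_bounds[OF tk_less ix_less \<rho>] unfolding g_def v_def by auto
    show "g \<in> floats p" by (simp add: g_def)
  qed
  have "hidden p T (toks k) 2 ?i = ff_sublayer p T (fetch_layer V (ix Bos) (ix ` Extra ` Q) nxt) v"
    unfolding hidden_2 f v_def e_def ..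
  also have "\<dots> = residual V (tk ?i) (\<lambda>u. if u = ix (Input b) then \<rho> else 0)
      (\<lambda>i. if i = nxt (tk ?i) (ix (Input b)) then tr ((if ix (Input b) = ix (Input b) then \<rho> else 0) / sel_norm ({..<2 * V} \<union> {3 * V + 4}) v) else 0)
      (a ?i) (c ?i) (d ?i) e"
    unfolding v_def using \<rho> q ti by (intro fetch_ff(2)) (auto simp: ix_less e_def)
  finally have h: "hidden p T (toks k) 2 ?i = residual V (tk ?i) (\<lambda>u. if u = ix (Input b) then \<rho> else 0)
      (\<lambda>i. if i = ix (Extra (state k)) then g else 0) (a ?i) (c ?i) (d ?i) e"
    unfolding ti nxt_ix[OF q b] sk g_def by simp
  have tQ: "tk ?i \<in> ix ` Extra ` Q" using ti q by simp
  have ext: "dot p (2 * half_dim V) (out_weights (Extra l)) (hidden p T (toks k) 2 ?i) =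
      (if l = state k then g else 0)" if "l < r" for l
    unfolding h using out_extra_state[OF tQ state_less that g(3)] .
  have acc: "dot p (2 * half_dim V) (out_weights Accept) (hidden p T (toks k) 2 ?i) =
      tr (tr (- 8 * e) + tr (of_bool (state k \<in> F) * (2 * g)))"
    unfolding h using out_accept_state[OF tQ state_in] .
  have acc1: "g < tr (tr (- 8 * e) + tr (of_bool (state k \<in> F) * (2 * g)))" if "k = length x" "state k \<in> F"
  proof -
    have "1 \<le> (real M)\<^sup>2" using M_ge by simp
    then have "8 \<le> 72 * (real M)\<^sup>2" by simp
    then have "1 / (72 * (real M)\<^sup>2) \<le> 1 / 8" by (rule divide_left_mono) (use M_ge in auto)
    then have "eta * (2 * g) \<le> tr (2 * g)" using g by (intro tr_relM) linarith+
    moreover have "99/100 * (2 * g) \<le> eta * (2 * g)" using eta_bounds g by (intro mult_right_mono) auto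
    ultimately have "g < tr (2 * g)" using g by linarith
    then show ?thesis using that e by simp
  qed
  have acc2: "tr (tr (- 8 * e) + tr (of_bool (state k \<in> F) * (2 * g))) < g"
    if "\<not> (k = length x \<and> state k \<in> F)"
  proof (cases "k = length x")
    case True
    then show ?thesis using that e g by simp
  next
    case False
    \<comment> \<open>Here \<open>e \<ge> 1/2\<close>, and \<open>Accept\<close> can gain at most
      \<open>2 * g \<le> 2\<close> from an accepting state.\<close>
    then have "- 8 * e \<le> - 4" using e by simp
    then have "tr (- 8 * e) \<le> - 4" by (rule tr_le[rotated]) simp
    moreover have "tr (of_bool (state k \<in> F) * (2 * g)) \<le> 2" using g by (intro tr_le) auto
    ultimately have "tr (tr (- 8 * e) + tr (of_bool (state k \<in> F) * (2 * g))) \<le> 0" by (intro tr_le) auto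
    then show ?thesis using g by linarith
  qed
  fix \<tau> assume \<tau>: "\<tau> \<in> vocab A r" "\<tau> \<noteq> ?y"
  have y: "dot p (2 * half_dim V) (out_weights ?y) (hidden p T (toks k) 2 ?i) \<ge> g"
    using acc1 acc ext[of "state k"] by auto
  show "dot p (2 * half_dim V) (out_weights \<tau>) (hidden p T (toks k) 2 ?i) <
    dot p (2 * half_dim V) (out_weights ?y) (hidden p T (toks k) 2 ?i)"
  proof (cases \<tau>)
    case Accept
    then have "\<not> (k = length x \<and> state k \<in> F)" using \<tau> by auto
    then show ?thesis using acc2 acc y Accept by simp
  next
    case (Extra l)
    show ?thesis
    proof (cases "k = length x \<and> state k \<in> F")
      case True
      then show ?thesis using acc1 acc ext[of l] \<tau>(1) g Extra by (auto split: if_splits)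
    next
      case False
      then have y': "?y = Extra (state k)" by (rule if_not_P)
      have "\<tau> \<noteq> Extra (state k)" using \<tau>(2) unfolding y' .
      then have "l \<noteq> state k" "l < r" using \<tau>(1) Extra by auto
      then show ?thesis using ext[of l] y g unfolding Extra by simp
    qed
  qed (use y g out_other in \<open>auto simp: out_other\<close>)
qed

end

context dfa_run
begin

lemma next_token_toks:
  assumes "k \<le> length x"
  shows "next_token A p T (toks k) = (if k = length x \<and> state k \<in> F then Accept else Extra (state k))"
proof -
  interpret dfa_step A Q \<delta> q0 F r V ix s p M x k by unfold_locales (fact assms)
  show ?thesis
    using next_token_start next_token_state by (cases "k = 0") (auto simp: state_def)
qed

lemma decode_toks: "k \<le> length x \<Longrightarrow> decode (next_token A p T) k (toks 0) = toks k"
  by (induction k) (simp_all add: Let_def next_token_toks, simp add: toks_def)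

lemma decode_accepts:
  "last (decode (next_token A p T) (length x + 1) (Bos # map Input x)) = Accept \<longleftrightarrow> foldl \<delta> q0 x \<in> F"
proof -
  have "toks 0 = Bos # map Input x" by (simp add: toks_def)
  then show ?thesis using decode_toks[of "length x"] next_token_toks[of "length x"]
    by (simp add: Let_def state_def)
qed

end

section \<open>Choice of the precision\<close>

lemma exists_no_pos_enc_transformer:
  fixes A :: "'a set" and L :: "'a list set"
  assumes "finite A" "regular_language A L"
  shows "\<exists>(T :: 'a transformer) p.
    log_precision_transformer A (\<lambda>n. n) p T \<and> no_pos_enc T \<and> checks_language A p T L"
proof -
  obtain Q :: "nat set" and \<delta> q0 F where fin: "finite Q" and q0: "q0 \<in> Q" and F: "F \<subseteq> Q"
    and \<delta>: "\<forall>q\<in>Q. \<forall>a\<in>A. \<delta> q a \<in> Q" and L: "L = {w \<in> lists A. foldl \<delta> q0 w \<in> F}"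
    using assms(2) unfolding regular_language_def by blast
  define r where "r = Suc (Max Q)"
  define V where "V = card (vocab A r)"
  have finV: "finite (vocab A r)" using assms(1) by (simp add: vocab_def)
  then obtain h where h: "bij_betw h (vocab A r) {0..<V}"
    unfolding V_def using ex_bij_betw_finite_nat by blast
  have V0: "0 < V" unfolding V_def using finV by (auto simp: card_gt_0_iff vocab_def)
  define ix where "ix = (\<lambda>\<sigma>. if \<sigma> \<in> vocab A r then h \<sigma> else 0)"
  interpret dfa A Q \<delta> q0 F r V ix
  proof
    show "Q \<subseteq> {..<r}" using fin by (auto simp: r_def less_Suc_eq_le)
    show "ix \<sigma> < V" for \<sigma> using h V0 by (auto simp: ix_def bij_betw_def)
    show "inj_on ix (vocab A r)" using h by (auto simp: ix_def bij_betw_def inj_on_def)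
  qed (use q0 F \<delta> in auto)
  define l where "l = (\<lambda>n::nat. nat \<lceil>log 2 (real n)\<rceil>)"
  \<comment> \<open>With \<open>M = 2 * n\<close>, \<open>precise\<close> asks for more than
    \<open>36 * (1 + 4 * n^2)^2 \<le> 900 * n^4\<close>. The summand \<open>4 * l n\<close> covers
    \<open>n^4\<close>, and \<open>2 ^ 10 = 1024\<close> covers 900.\<close>
  define s where "s = (\<lambda>n. 4 * l n + 10)"
  define p where "p = (\<lambda>n. 2 * s n + 2)"
  have fmt: "float_format (s n) (p n)" for n by unfold_locales (simp_all add: s_def p_def)
  have prec: "36 * (1 + (real (2 * n))\<^sup>2)\<^sup>2 < 2 ^ s n" if n: "1 \<le> n" for n
  proof -
    have "log 2 (real n) \<le> real (l n)" unfolding l_def using of_nat_ceiling by blast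
    then have "real n \<le> 2 powr real (l n)" using n by (simp add: log_le_iff)
    then have nl: "real n \<le> 2 ^ l n" by (simp add: powr_realpow)
    have n1: "1 \<le> (real n)\<^sup>2" using n by simp
    have "(1 + (real (2 * n))\<^sup>2)\<^sup>2 \<le> (5 * (real n)\<^sup>2)\<^sup>2" using n1 by (intro power_mono) (auto simp: power2_eq_square)
    also have "\<dots> = 25 * real n ^ 4" by (simp add: power_mult_distrib flip: power_mult)
    finally have "36 * (1 + (real (2 * n))\<^sup>2)\<^sup>2 \<le> 900 * real n ^ 4" by simp
    also have "\<dots> < 1024 * real n ^ 4" using n by simp
    also have "\<dots> \<le> 1024 * (2 ^ l n) ^ 4" using nl by (intro mult_left_mono power_mono) auto
    also have "\<dots> = 2 ^ s n" by (simp add: s_def power_add power_mult mult.commute flip: power_mult)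
    finally show ?thesis .
  qed
  \<comment> \<open>\<open>p n = 8 * l n + 22 \<le> 8 * log 2 n + 30\<close>, and
    \<open>log 2 (n + n) = 1 + log 2 n\<close> absorbs the constant even at
    \<open>n = 1\<close>.\<close>
  have "real (p n) \<le> 30 * log 2 (real (n + n))" if n: "1 \<le> n" for n
  proof -
    have lg: "log 2 (real (n + n)) = 1 + log 2 (real n)"
      using n log_mult[of 2 "real n" 2] by (simp add: mult.commute flip: mult_2)
    have l0: "0 \<le> log 2 (real n)" using n by simp
    then have "real (l n) \<le> log 2 (real n) + 1" unfolding l_def by linarith
    then show ?thesis unfolding lg p_def s_def using l0 by simp
  qed
  then have "log_precision_transformer A (\<lambda>n. n) p dfa_transformer"
    unfolding log_precision_transformer_def
    using params_in_dfa_transformer[OF fmt] log_time_computable_zero float_format.floats_simps(1)[OF fmt]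
    by (auto simp: vec_in_def)
  moreover have "no_pos_enc dfa_transformer" by (simp add: no_pos_enc_def)
  moreover have "checks_language A p dfa_transformer L"
    unfolding checks_language_def
  proof
    fix x assume x: "x \<in> lists A"
    \<comment> \<open>The precision is indexed by the length of the prompt, which includes
      \<open>Bos\<close>; doubling that length covers the generated tokens.\<close>
    interpret dfa_run A Q \<delta> q0 F r V ix "s (length x + 1)" "p (length x + 1)" "2 * (length x + 1)" x
      using fmt[of "length x + 1"] prec[of "length x + 1"] x dfa_axioms
      unfolding dfa_run_def attention_precision_def attention_precision_axioms_def dfa_run_axioms_def by auto
    show "last (decode (next_token A (p (length x + 1)) dfa_transformer) (length x + 1) (Bos # map Input x)) = Accept
        \<longleftrightarrow> x \<in> L"
      using decode_accepts x L by simp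
  qed
  ultimately show ?thesis by blast
qed

theorem theorem1:
  fixes A :: "'a set" and L :: "'a list set"
  assumes "finite A" and "L \<subseteq> lists A" and "regular_language A L"
  shows "(\<exists>(T :: 'a transformer) p.
            log_precision_transformer A (\<lambda>n. n) p T \<and> checks_language A p T L) \<and>
         (\<exists>(T :: 'a transformer) p.
            log_precision_transformer A (\<lambda>n. n) p T \<and> no_pos_enc T \<and> checks_language A p T L)"
  \<comment> \<open>The zero encoding is an admissible positional encoding, so one transformer
    witnesses both variants.\<close>
  using exists_no_pos_enc_transformer[OF assms(1,3)] by blast

end
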